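(* Let $K$ be a totally real number field of degree $n \geq 2$ with ring of integers $\mathcal{O}_K$, real embeddings $\sigma_1,\dots,\sigma_n : K \to \mathbb{R}$ and different $\mathfrak{d}$. Let $c \in K^{\times}$ and let $\mathfrak{a} \subset K$ be a fractional ideal such that $c\,\mathfrak{a}^2 = \mathfrak{d}^{-1}$. Let $V \subset \mathcal{S}(\mathbb{R}^n)$ denote the complex linear span of all Gaussians $x=(x_1,\dots,x_n) \mapsto e^{\pi i z_1 x_1^2}\cdots e^{\pi i z_n x_n^2}$ with $z_1,\dots,z_n \in \mathbb{H}$. Then for every $\epsilon \in \{\pm 1\}$ the subspace of all $f \in V$ satisfying $\widehat{f} = \epsilon f$ and $f(x)=0$ for all $x \in E(c,\mathfrak{a})$ is infinite dimensional.
   Context: $\mathbb{H} = \{z \in \mathbb{C} : \operatorname{Im}(z)>0\}$. $\mathcal{S}(\mathbb{R}^n)$ is the space of complex-valued Schwartz functions. The Fourier transform is $\widehat{f}(\xi) = \int_{\mathbb{R}^n} f(x) e^{-2\pi i \langle x,\xi\rangle}dx$. The codifferent is $\mathcal{O}_K^{\vee} = \{x \in K : \operatorname{Tr}_{K/\mathbb{Q}}(ax) \in \mathbb{Z} \text{ for all } a \in \mathcal{O}_K\}$ and the different is $\mathfrak{d} = (\mathcal{O}_K^{\vee})^{-1}$, so $\mathfrak{d}^{-1} = \mathcal{O}_K^\vee$. The set $E(c,\mathfrak{a})$ is $$E(c,\mathfrak{a}) := \{x \in \mathbb{R}^n : \exists\, \alpha \in \mathfrak{a}^2 \text{ such that }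 \sigma_j(\alpha) = x_j^2/|\sigma_j(c)| \text{ for all } j=1,\dots,n\}.$$ *)

theory Defs
  imports "HOL-Analysis.Analysis" "HOL-Library.Function_Algebras"
begin

section \<open>Number fields\<close>

text \<open>
  A number field is a type \<open>'k\<close> of class \<open>field_char_0\<close> that is
  finite-dimensional as a vector space over \<open>rat\<close>.
\<close>

global_interpretation ratvs: vector_space "\<lambda>(q::rat) (x::'k::field_char_0). of_rat q * x"
  by unfold_locales (simp_all add: algebra_simps of_rat_add of_rat_mult)

definition number_field :: "'k::field_char_0 itself \<Rightarrow> bool" where
  "number_field _ \<longleftrightarrow> (\<exists>B::'k set. finite B \<and> ratvs.span B = UNIV)"

definition field_degree :: "'k::field_char_0 itself \<Rightarrow> nat" where
  "field_degree _ = ratvs.dim (UNIV :: 'k set)"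

text \<open>Injectivity is automatic for homomorphisms of fields.\<close>

definition field_embedding :: "('k::field \<Rightarrow> 'l::field) \<Rightarrow> bool" where
  "field_embedding \<tau> \<longleftrightarrow>
     \<tau> 1 = 1 \<and> (\<forall>x y. \<tau> (x + y) = \<tau> x + \<tau> y) \<and> (\<forall>x y. \<tau> (x * y) = \<tau> x * \<tau> y)"

definition totally_real :: "'k::field_char_0 itself \<Rightarrow> bool" where
  "totally_real _ \<longleftrightarrow> (\<forall>\<tau> :: 'k \<Rightarrow> complex. field_embedding \<tau> \<longrightarrow> range \<tau> \<subseteq> \<real>)"

definition ring_of_integers :: "'k::field_char_0 set" where
  "ring_of_integers = {x. algebraic_int x}"

text \<open>
  The trace of the rational-linear endomorphism \<open>y \<mapsto> x * y\<close>: the sum of the diagonal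
  entries of its matrix with respect to some basis, \<open>extend_basis {}\<close> being a basis of the
  whole space. It does not depend on the basis when the dimension is finite.
\<close>

definition field_trace :: "'k::field_char_0 \<Rightarrow> rat" where
  "field_trace x =
     (let B = ratvs.extend_basis ({} :: 'k set)
      in \<Sum>b\<in>B. ratvs.representation B (x * b) b)"

text \<open>
  The different is the inverse of the codifferent in the group of fractional ideals;
  the codifferent is thus the inverse of the different.
\<close>

definition codifferent :: "'k::field_char_0 set" where
  "codifferent = {x. \<forall>a\<in>ring_of_integers. field_trace (a * x) \<in> \<int>}"

definition fractional_ideal :: "'k::field_char_0 set \<Rightarrow> bool" where
  "fractional_ideal I \<longleftrightarrow>
     0 \<in> I \<and> (\<forall>x\<in>I. \<forall>y\<in>I. x + y \<in> I) \<and> (\<forall>r\<in>ring_of_integers. \<forall>x\<in>I. r * x \<in> I) \<and>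
     I \<noteq> {0} \<and>
     (\<exists>d\<in>ring_of_integers. d \<noteq> 0 \<and> (\<forall>x\<in>I. d * x \<in> ring_of_integers))"

definition ideal_prod :: "'k::field_char_0 set \<Rightarrow> 'k set \<Rightarrow> 'k set" where
  "ideal_prod I J =
     {\<Sum>i<m. f i * g i | (m::nat) f g. (\<forall>i<m. f i \<in> I) \<and> (\<forall>i<m. g i \<in> J)}"


section \<open>Gaussians and the Fourier transform\<close>

global_interpretation cfun: vector_space "\<lambda>(c::complex) (f::'a \<Rightarrow> complex) x. c * f x"
  by unfold_locales (simp_all add: fun_eq_iff algebra_simps)

definition infinite_dim_subspace :: "('a \<Rightarrow> complex) set \<Rightarrow> bool" where
  "infinite_dim_subspace W \<longleftrightarrow>
     cfun.subspace W \<and> \<not> (\<exists>B. finite B \<and> cfun.span B = W)"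

definition fourier :: "(real^'n \<Rightarrow> complex) \<Rightarrow> real^'n \<Rightarrow> complex" where
  "fourier f \<xi> =
     (\<integral>x. f x * exp (- 2 * of_real pi * \<i> * of_real (x \<bullet> \<xi>)) \<partial>lborel)"

definition gaussian :: "complex^'n \<Rightarrow> real^'n \<Rightarrow> complex" where
  "gaussian z x = (\<Prod>j\<in>UNIV. exp (of_real pi * \<i> * z $ j * of_real ((x $ j)\<^sup>2)))"

text \<open>
  Each such Gaussian is a Schwartz function, so the span in the space of all functions is
  the span in the Schwartz space.
\<close>

definition gaussian_span :: "(real^'n \<Rightarrow> complex) set" where
  "gaussian_span = cfun.span {gaussian z | z. \<forall>j. Im (z $ j) > 0}"

definition E_set :: "('n \<Rightarrow> 'k::field_char_0 \<Rightarrow> real) \<Rightarrow> 'k \<Rightarrow> 'k set \<Rightarrow> (real^'n) set" where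
  "E_set \<sigma> c \<aa> =
     {x. \<exists>\<alpha>\<in>ideal_prod \<aa> \<aa>. \<forall>j. \<sigma> j \<alpha> = (x $ j)\<^sup>2 / \<bar>\<sigma> j c\<bar>}"

end

theory Submission
  imports Defs "HOL-Probability.Characteristic_Functions" "HOL-Complex_Analysis.Conformal_Mappings"
begin

text \<open>
  For \<open>z\<close> in the product of upper half planes, let \<open>g z\<close> be the Gaussian and \<open>S z = - 1 / z\<close>, so that the
  Fourier transform of \<open>g z\<close> is a multiple of \<open>g (S z)\<close> and \<open>F z = g z + \<epsilon> * fourier (g z)\<close> is an
  eigenfunction. On \<open>E(c, \<aa>)\<close> the function \<open>g z\<close> only depends on \<open>z\<close> modulo the lattice of all
  \<open>(2 * sgn (\<sigma> j c) * \<sigma> j r)\<close> with \<open>r\<close> an algebraic integer, since \<open>c * \<aa>\<^sup>2\<close> is the codifferent.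
  As \<open>n \<ge> 2\<close>, there is a unit \<open>u \<noteq> \<plusminus>1\<close> congruent to \<open>1\<close> modulo \<open>4\<close>, and then \<open>diag(u, 1/u)\<close> is a word
  with four letters \<open>S\<close> and four lattice translations. Starting this word at any lattice translate
  \<open>v\<close> of a base point gives points \<open>v = q0, q1, q2, q3\<close> and a combination of
  \<open>F q0, F q1, F q2, F q3\<close> whose restriction to \<open>E(c, \<aa>)\<close> telescopes to a combination of two functions:
  the Gaussians at the base point and at its image under the word. Neither depends on \<open>v\<close>, because
  \<open>diag(u, 1/u)\<close> normalises the lattice. Hence any three of these infinitely many linearly independent
  eigenfunctions have a nontrivial combination that vanishes on \<open>E(c, \<aa>)\<close>.
\<close>

section \<open>Embeddings, trace and units\<close>

text \<open>Artin's argument for the independence of characters. The operation \<open>m\<close> and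
  the point \<open>e\<close> are arbitrary because there are two uses: field embeddings with
  multiplication, and Gaussians, which are multiplicative for
  \<open>sqrt (x\<^sup>2 + y\<^sup>2)\<close> taken in each coordinate.\<close>

lemma dedekind_independence:
  fixes \<phi> :: "'i \<Rightarrow> 'a \<Rightarrow> 'f::field"
  assumes "finite I"
    and mult: "\<And>i x y. i \<in> I \<Longrightarrow> \<phi> i (m x y) = \<phi> i x * \<phi> i y"
    and one: "\<And>i. i \<in> I \<Longrightarrow> \<phi> i e = 1"
    and inj: "inj_on \<phi> I"
    and zero: "\<And>x. (\<Sum>i\<in>I. c i * \<phi> i x) = 0"
    and "i \<in> I"
  shows "c i = 0"
proof -
  have "\<forall>i\<in>I. c i = 0"
    using assms(1-5)
  proof (induction I arbitrary: c rule: finite_induct)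
    case empty
    then show ?case by simp
  next
    case (insert k I)
    have sum0: "c k * \<phi> k x + (\<Sum>i\<in>I. c i * \<phi> i x) = 0" for x
      using insert.prems(4)[of x] insert.hyps by simp
    \<comment> \<open>Subtracting \<open>\<phi> k y\<close> times the relation at \<open>x\<close>
      from the relation at \<open>m y x\<close> cancels the term of index \<open>k\<close>; the
      shorter relation falls under the induction hypothesis.\<close>
    have "\<forall>i\<in>I. c i * (\<phi> i y - \<phi> k y) = 0" for y
    proof (rule insert.IH)
      fix x
      have "(\<Sum>i\<in>I. c i * (\<phi> i y - \<phi> k y) * \<phi> i x)
          = (\<Sum>i\<in>I. c i * \<phi> i (m y x)) - \<phi> k y * (\<Sum>i\<in>I. c i * \<phi> i x)"
        unfolding sum_distrib_left sum_subtractf[symmetric]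
        by (rule sum.cong) (use insert.prems(1) in \<open>auto simp: algebra_simps\<close>)
      also have "\<dots> = - (c k * \<phi> k (m y x)) - \<phi> k y * (- (c k * \<phi> k x))"
        using sum0[of x] sum0[of "m y x"] by (simp add: eq_neg_iff_add_eq_0[symmetric])
      also have "\<dots> = 0"
        using insert.prems(1)[of k y x] by simp
      finally show "(\<Sum>i\<in>I. c i * (\<phi> i y - \<phi> k y) * \<phi> i x) = 0" .
    qed (use insert.prems in \<open>auto simp: inj_on_def\<close>)
    moreover have "\<exists>y. \<phi> i y \<noteq> \<phi> k y" if "i \<in> I" for i
      using insert.prems(3) insert.hyps(2) that by (auto simp: inj_on_def fun_eq_iff)
    ultimately have cI: "\<forall>i\<in>I. c i = 0"
      by (metis mult_eq_0_iff right_minus_eq)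
    then have "c k * \<phi> k e = 0"
      using sum0[of e] by simp
    then show ?case
      using cI insert.prems(2)[of k] by simp
  qed
  then show ?thesis using \<open>i \<in> I\<close> by blast
qed

section \<open>Field embeddings, conjugates and the trace\<close>

lemma field_embedding_add: "field_embedding \<tau> \<Longrightarrow> \<tau> (x + y) = \<tau> x + \<tau> y"
  and field_embedding_mult: "field_embedding \<tau> \<Longrightarrow> \<tau> (x * y) = \<tau> x * \<tau> y"
  and field_embedding_1: "field_embedding \<tau> \<Longrightarrow> \<tau> 1 = 1"
  by (simp_all add: field_embedding_def)

lemma field_embedding_0: "field_embedding \<tau> \<Longrightarrow> \<tau> 0 = 0"
  using field_embedding_add[of \<tau> 0 0] by (metis add_0 add_cancel_right_left)

lemma field_embedding_minus: "field_embedding \<tau> \<Longrightarrow> \<tau> (- x) = - \<tau> x"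
  using field_embedding_add[of \<tau> x "- x"] field_embedding_0[of \<tau>]
  by (simp add: eq_neg_iff_add_eq_0 add.commute)

lemma field_embedding_diff: "field_embedding \<tau> \<Longrightarrow> \<tau> (x - y) = \<tau> x - \<tau> y"
  using field_embedding_add[of \<tau> x "- y"] field_embedding_minus[of \<tau> y] by simp

lemma field_embedding_sum: "field_embedding \<tau> \<Longrightarrow> \<tau> (sum f A) = (\<Sum>x\<in>A. \<tau> (f x))"
  by (induction A rule: infinite_finite_induct)
    (simp_all add: field_embedding_0 field_embedding_add)

lemma field_embedding_eq_0_iff: "field_embedding \<tau> \<Longrightarrow> \<tau> x = 0 \<longleftrightarrow> x = 0"
  using field_embedding_mult[of \<tau> x "inverse x"] field_embedding_1[of \<tau>] field_embedding_0[of \<tau>]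
  by (cases "x = 0") auto

lemma field_embedding_eq_iff: "field_embedding \<tau> \<Longrightarrow> \<tau> x = \<tau> y \<longleftrightarrow> x = y"
  using field_embedding_eq_0_iff[of \<tau> "x - y"] by (simp add: field_embedding_diff)

lemma field_embedding_inverse: "field_embedding \<tau> \<Longrightarrow> \<tau> (inverse x) = inverse (\<tau> x)"
  using field_embedding_mult[of \<tau> x "inverse x"] field_embedding_1[of \<tau>] field_embedding_0[of \<tau>]
  by (cases "x = 0") (auto intro: inverse_unique[symmetric])

lemma field_embedding_of_nat: "field_embedding \<tau> \<Longrightarrow> \<tau> (of_nat n) = of_nat n"
  by (induction n) (simp_all add: field_embedding_0 field_embedding_1 field_embedding_add)

lemma field_embedding_of_int: "field_embedding \<tau> \<Longrightarrow> \<tau> (of_int n) = of_int n"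
  by (cases n) (simp_all add: field_embedding_of_nat field_embedding_minus field_embedding_add field_embedding_diff field_embedding_1)

lemma field_embedding_of_rat:
  fixes \<tau> :: "'k::field_char_0 \<Rightarrow> 'l::field_char_0"
  shows "field_embedding \<tau> \<Longrightarrow> \<tau> (of_rat q) = of_rat q"
  by (cases q)
    (simp add: of_rat_rat divide_inverse field_embedding_mult field_embedding_inverse
      field_embedding_of_int)

text \<open>As many distinct embeddings as the degree, so that the matrix of conjugates of a
  rational basis is square.\<close>

locale real_embeddings =
  fixes \<sigma> :: "'n::finite \<Rightarrow> 'k::field_char_0 \<Rightarrow> real"
  assumes number_field: "number_field TYPE('k)"
    and degree: "field_degree TYPE('k) = CARD('n)"
    and emb: "\<And>j. field_embedding (\<sigma> j)"
    and inj_\<sigma>: "inj \<sigma>"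
begin

lemmas emb_simps = field_embedding_add[OF emb] field_embedding_mult[OF emb] field_embedding_1[OF emb]
  field_embedding_0[OF emb] field_embedding_minus[OF emb] field_embedding_diff[OF emb]
  field_embedding_sum[OF emb] field_embedding_eq_0_iff[OF emb] field_embedding_eq_iff[OF emb]
  field_embedding_inverse[OF emb] field_embedding_of_nat[OF emb] field_embedding_of_int[OF emb]
  field_embedding_of_rat[OF emb]

lemma basis_bij:
  assumes "ratvs.independent (B :: 'k set)" "ratvs.span B = UNIV"
  obtains \<beta> :: "'n \<Rightarrow> 'k" where "bij_betw \<beta> UNIV B"
proof -
  obtain S :: "'k set" where "finite S" "ratvs.span S = UNIV"
    using number_field by (auto simp: number_field_def)
  then have "finite B"
    using ratvs.independent_span_bound[of S B] assms by auto
  moreover have "card B = CARD('n)"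
    using ratvs.dim_eq_card[of B UNIV] assms degree by (simp add: field_degree_def)
  ultimately show ?thesis
    using that finite_same_card_bij[of "UNIV :: 'n set" B] by auto
qed

lemma span_UNIV_coordinates:
  assumes "bij_betw \<beta> (UNIV :: 'n set) B" "ratvs.independent (B :: 'k set)" "ratvs.span B = UNIV"
  shows "x = (\<Sum>i\<in>UNIV. of_rat (ratvs.representation B x (\<beta> i)) * \<beta> i)"
proof -
  have "finite B" using bij_betw_finite[OF assms(1)] by simp
  then have "x = (\<Sum>b\<in>B. of_rat (ratvs.representation B x b) * b)"
    using ratvs.sum_representation_eq[of B x B] assms by simp
  also have "\<dots> = (\<Sum>i\<in>UNIV. of_rat (ratvs.representation B x (\<beta> i)) * \<beta> i)"
    using sum.reindex_bij_betw[OF assms(1), of "\<lambda>b. of_rat (ratvs.representation B x b) * b"] by simp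
  finally show ?thesis .
qed

text \<open>A vector in the kernel is a linear relation between the embeddings on the
  \<open>\<omega> i\<close>. It extends to the whole field by rational linearity, against Dedekind's
  theorem.\<close>

lemma det_embedding_matrix:
  fixes \<omega> :: "'n \<Rightarrow> 'k"
  assumes span: "\<And>x. \<exists>q. x = (\<Sum>i\<in>UNIV. of_rat (q i) * \<omega> i)"
  shows "det (\<chi> i j. \<sigma> j (\<omega> i)) \<noteq> 0"
proof
  assume "det (\<chi> i j. \<sigma> j (\<omega> i)) = 0"
  then obtain v :: "real^'n" where "v \<noteq> 0" and v: "(\<chi> i j. \<sigma> j (\<omega> i)) *v v = 0"
    by (metis invertible_det_nz invertible_left_inverse matrix_left_invertible_ker)
  have v': "(\<Sum>j\<in>UNIV. \<sigma> j (\<omega> i) * v $ j) = 0" for i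
    using v by (simp add: matrix_vector_mult_def vec_eq_iff)
  have "(\<Sum>j\<in>UNIV. v $ j * \<sigma> j x) = 0" for x
  proof -
    obtain q where q: "x = (\<Sum>i\<in>UNIV. of_rat (q i) * \<omega> i)" using span by blast
    have "(\<Sum>j\<in>UNIV. v $ j * \<sigma> j x) = (\<Sum>j\<in>UNIV. \<Sum>i\<in>UNIV. of_rat (q i) * (\<sigma> j (\<omega> i) * v $ j))"
      by (simp add: q emb_simps sum_distrib_left mult_ac)
    also have "\<dots> = (\<Sum>i\<in>UNIV. of_rat (q i) * (\<Sum>j\<in>UNIV. \<sigma> j (\<omega> i) * v $ j))"
      by (subst sum.swap) (simp add: sum_distrib_left)
    finally show ?thesis by (simp add: v')
  qed
  then have "v $ j = 0" for j
    using dedekind_independence[of UNIV \<sigma> "(*)" 1 "\<lambda>j. v $ j" j] inj_\<sigma> by (simp add: emb_simps)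
  with \<open>v \<noteq> 0\<close> show False by (simp add: vec_eq_iff)
qed

text \<open>The matrix of conjugates diagonalises multiplication by \<open>x\<close>:
  \<open>A' ** \<Omega> = \<Omega> ** D\<close>, where \<open>D\<close> carries the conjugates of
  \<open>x\<close>. Trace and determinant are therefore those of \<open>D\<close>.\<close>

lemma trace_det_multiplication_matrix:
  fixes \<omega> :: "'n \<Rightarrow> 'k" and A :: "'n \<Rightarrow> 'n \<Rightarrow> rat"
  assumes span: "\<And>x. \<exists>q. x = (\<Sum>i\<in>UNIV. of_rat (q i) * \<omega> i)"
    and A: "\<And>i. x * \<omega> i = (\<Sum>j\<in>UNIV. of_rat (A i j) * \<omega> j)"
  shows "trace (\<chi> i j. real_of_rat (A i j)) = (\<Sum>j\<in>UNIV. \<sigma> j x)"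
    and "det (\<chi> i j. real_of_rat (A i j)) = (\<Prod>j\<in>UNIV. \<sigma> j x)"
proof -
  define \<Omega> :: "real^'n^'n" where "\<Omega> = (\<chi> i j. \<sigma> j (\<omega> i))"
  define D :: "real^'n^'n" where "D = (\<chi> i j. if i = j then \<sigma> i x else 0)"
  define A' :: "real^'n^'n" where "A' = (\<chi> i j. of_rat (A i j))"
  have det0: "det \<Omega> \<noteq> 0" unfolding \<Omega>_def by (rule det_embedding_matrix[OF span])
  then obtain \<Omega>' where inv: "\<Omega> ** \<Omega>' = mat 1" "\<Omega>' ** \<Omega> = mat 1"
    using invertible_det_nz[of \<Omega>] by (auto simp: invertible_def)
  have eq: "A' ** \<Omega> = \<Omega> ** D"
  proof -
    have "(\<Sum>k\<in>UNIV. of_rat (A i k) * \<sigma> j (\<omega> k)) = \<sigma> j (\<omega> i) * \<sigma> j x" for i j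
      using arg_cong[OF A[of i], of "\<sigma> j"] by (simp add: emb_simps mult.commute)
    then show ?thesis
      by (simp add: A'_def \<Omega>_def D_def matrix_matrix_mult_def vec_eq_iff if_distrib cong: if_cong)
  qed
  have "A' = A' ** (\<Omega> ** \<Omega>')" by (simp add: inv)
  also have "\<dots> = \<Omega> ** D ** \<Omega>'" by (simp add: matrix_mul_assoc eq)
  finally have "trace A' = trace (\<Omega>' ** (\<Omega> ** D))" using trace_mul_sym[of "\<Omega> ** D" \<Omega>'] by simp
  also have "\<dots> = trace D" by (simp add: matrix_mul_assoc inv)
  finally show "trace (\<chi> i j. real_of_rat (A i j)) = (\<Sum>j\<in>UNIV. \<sigma> j x)"
    by (simp add: A'_def D_def trace_def)
  have "det A' * det \<Omega> = det \<Omega> * det D"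
    using arg_cong[OF eq, of det] by (simp add: det_mul)
  then have "det A' = det D" using det0 by simp
  also have "det D = (\<Prod>j\<in>UNIV. D $ j $ j)" by (rule det_diagonal) (simp add: D_def)
  finally show "det (\<chi> i j. real_of_rat (A i j)) = (\<Prod>j\<in>UNIV. \<sigma> j x)"
    by (simp add: A'_def D_def)
qed

lemma field_trace_eq_sum_embeddings: "real_of_rat (field_trace x) = (\<Sum>j\<in>UNIV. \<sigma> j x)"
proof -
  define B where "B = ratvs.extend_basis ({} :: 'k set)"
  have B: "ratvs.independent B" "ratvs.span B = UNIV"
    unfolding B_def
    by (rule ratvs.independent_extend_basis ratvs.span_extend_basis, rule ratvs.independent_empty)+
  obtain \<beta> :: "'n \<Rightarrow> 'k" where \<beta>: "bij_betw \<beta> UNIV B" using basis_bij[OF B] .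
  note coord = span_UNIV_coordinates[OF \<beta> B]
  have "trace (\<chi> i j. real_of_rat (ratvs.representation B (x * \<beta> i) (\<beta> j))) = (\<Sum>j\<in>UNIV. \<sigma> j x)"
    by (rule trace_det_multiplication_matrix(1)[of \<beta>]) (rule exI, rule coord, rule coord)
  moreover have "field_trace x = (\<Sum>i\<in>UNIV. ratvs.representation B (x * \<beta> i) (\<beta> i))"
    unfolding field_trace_def Let_def B_def[symmetric]
    using sum.reindex_bij_betw[OF \<beta>, of "\<lambda>b. ratvs.representation B (x * b) b"] by simp
  ultimately show ?thesis by (simp add: trace_def of_rat_sum)
qed

end

section \<open>Orders, integrality and norms\<close>

definition int_span :: "('n::finite \<Rightarrow> 'k::field_char_0) \<Rightarrow> 'k set" where
  "int_span \<omega> = range (\<lambda>m. \<Sum>i\<in>UNIV. of_int (m i) * \<omega> i)"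

lemma int_spanI: "x = (\<Sum>i\<in>UNIV. of_int (m i) * \<omega> i) \<Longrightarrow> x \<in> int_span \<omega>"
  by (auto simp: int_span_def)

lemma int_span_base: "\<omega> j \<in> int_span \<omega>"
  by (rule int_spanI[of _ "\<lambda>i. if i = j then 1 else 0"]) (simp add: if_distrib if_distribR cong: if_cong)

lemma int_span_add:
  assumes "x \<in> int_span \<omega>" "y \<in> int_span \<omega>"
  shows "x + y \<in> int_span \<omega>"
proof -
  obtain m m' where "x = (\<Sum>i\<in>UNIV. of_int (m i) * \<omega> i)" "y = (\<Sum>i\<in>UNIV. of_int (m' i) * \<omega> i)"
    using assms by (auto simp: int_span_def)
  then show ?thesis
    by (intro int_spanI[of _ "\<lambda>i. m i + m' i"]) (simp add: algebra_simps sum.distrib)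
qed

lemma int_span_of_int_mult:
  assumes "x \<in> int_span \<omega>"
  shows "of_int k * x \<in> int_span \<omega>"
proof -
  obtain m where "x = (\<Sum>i\<in>UNIV. of_int (m i) * \<omega> i)"
    using assms by (auto simp: int_span_def)
  then show ?thesis
    by (intro int_spanI[of _ "\<lambda>i. k * m i"]) (simp add: sum_distrib_left mult.assoc)
qed

lemma int_span_0: "0 \<in> int_span \<omega>"
  by (rule int_spanI[of _ "\<lambda>_. 0"]) simp

lemma int_span_minus: "x \<in> int_span \<omega> \<Longrightarrow> - x \<in> int_span \<omega>"
  using int_span_of_int_mult[of x \<omega> "-1"] by simp

lemma int_span_sum: "(\<And>a. a \<in> A \<Longrightarrow> f a \<in> int_span \<omega>) \<Longrightarrow> sum f A \<in> int_span \<omega>"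
  by (induction A rule: infinite_finite_induct) (simp_all add: int_span_0 int_span_add)

text \<open>Under these conditions \<open>int_span \<omega>\<close> is a ring. It stands in for the
  ring of integers because it comes with a finite integral basis, on which the box argument and the
  residues rely.\<close>

locale order_basis =
  fixes \<omega> :: "'n::finite \<Rightarrow> 'k::field_char_0" and i0 :: 'n
  assumes one: "\<omega> i0 = 1"
    and mult: "\<And>i j. \<omega> i * \<omega> j \<in> int_span \<omega>"
begin

lemma int_span_mult:
  assumes "x \<in> int_span \<omega>" "y \<in> int_span \<omega>"
  shows "x * y \<in> int_span \<omega>"
proof -
  obtain m m' where "x = (\<Sum>i\<in>UNIV. of_int (m i) * \<omega> i)" "y = (\<Sum>i\<in>UNIV. of_int (m' i) * \<omega> i)"
    using assms by (auto simp: int_span_def)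
  then have "x * y = (\<Sum>i\<in>UNIV. \<Sum>j\<in>UNIV. (of_int (m i) * \<omega> i) * (of_int (m' j) * \<omega> j))"
    by (simp only: sum_product)
  also have "\<dots> = (\<Sum>i\<in>UNIV. \<Sum>j\<in>UNIV. of_int (m i * m' j) * (\<omega> i * \<omega> j))"
    by (simp add: mult_ac)
  also have "\<dots> \<in> int_span \<omega>"
    by (intro int_span_sum int_span_of_int_mult mult)
  finally show ?thesis .
qed

lemma int_span_of_int: "of_int k \<in> int_span \<omega>"
  using int_span_of_int_mult[OF int_span_base[of \<omega> i0], of k] by (simp add: one)

lemma int_span_1: "1 \<in> int_span \<omega>"
  using int_span_of_int[of 1] by simp

lemma int_span_prod: "(\<And>a. a \<in> A \<Longrightarrow> f a \<in> int_span \<omega>) \<Longrightarrow> prod f A \<in> int_span \<omega>"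
  by (induction A rule: infinite_finite_induct) (simp_all add: int_span_1 int_span_mult)

lemma multiplication_matrix:
  assumes "x \<in> int_span \<omega>"
  obtains A :: "'n \<Rightarrow> 'n \<Rightarrow> int" where "\<forall>i. x * \<omega> i = (\<Sum>j\<in>UNIV. of_int (A i j) * \<omega> j)"
proof -
  have "\<forall>i. \<exists>m. x * \<omega> i = (\<Sum>j\<in>UNIV. of_int (m j :: int) * \<omega> j)"
    using int_span_mult[OF assms int_span_base] by (fastforce simp: int_span_def)
  from choice[OF this] show ?thesis using that by blast
qed

text \<open>The characteristic polynomial of multiplication by \<open>x\<close> annihilates \<open>x\<close>.\<close>

lemma algebraic_int_int_span:
  assumes "x \<in> int_span \<omega>"
  shows "algebraic_int x"
proof -
  obtain A where A: "\<forall>i. x * \<omega> i = (\<Sum>j\<in>UNIV. of_int (A i j) * \<omega> j)"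
    using multiplication_matrix[OF assms] .
  \<comment> \<open>\<open>P\<close> holds the entries of the characteristic matrix and
    \<open>t\<close> the terms of its Leibniz expansion. The identity contributes a monic term of
    degree \<open>CARD('n)\<close>; any other permutation meets a constant entry and stays below
    that degree.\<close>
  define P where "P i j = (if i = j then [:- of_int (A i j), 1:] else [:- of_int (A i j) :: 'k:])" for i j
  define t where "t p = of_int (sign p) * (\<Prod>i\<in>UNIV. P i (p i))" for p
  define U where "U = {p :: 'n \<Rightarrow> 'n. p permutes UNIV}"
  define f where "f = (\<Sum>p\<in>U. t p)"
  have [simp]: "finite U" by (simp add: U_def finite_permutations)
  have f: "f = det (\<chi> i j. P i j)" by (simp add: f_def t_def U_def det_def)
  have t_id: "lead_coeff (t id) = 1" "degree (t id) = CARD('n)"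
  proof -
    have P: "P i i = [:- of_int (A i i), 1:]" for i by (simp add: P_def)
    show "lead_coeff (t id) = 1" by (simp add: t_def P lead_coeff_prod)
    show "degree (t id) = CARD('n)" by (simp add: t_def P degree_prod_eq_sum_degree)
  qed
  have t_other: "degree (t p) < CARD('n)" if "p \<noteq> id" for p
  proof -
    obtain i where i: "p i \<noteq> i" using \<open>p \<noteq> id\<close> by (auto simp: fun_eq_iff)
    have "degree (t p) \<le> degree (\<Prod>i\<in>UNIV. P i (p i))"
      by (simp add: t_def sign_def degree_minus)
    also have "\<dots> \<le> (\<Sum>i\<in>UNIV. degree (P i (p i)))"
      using degree_prod_sum_le[of UNIV "\<lambda>i. P i (p i)"] by (simp add: o_def)
    also have "\<dots> < (\<Sum>i\<in>(UNIV :: 'n set). 1)"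
      by (rule sum_strict_mono_ex1) (use i in \<open>auto simp: P_def intro!: exI[of _ i]\<close>)
    finally show ?thesis by simp
  qed
  have "id \<in> U" by (simp add: U_def permutes_id)
  then have f_split: "f = t id + (\<Sum>p\<in>U - {id}. t p)"
    by (simp add: f_def sum.remove)
  have "degree (\<Sum>p\<in>U - {id}. t p) < CARD('n)"
    by (rule degree_sum_less) (auto intro: t_other)
  then have "lead_coeff f = 1"
    using t_id by (simp add: f_split lead_coeff_add_le add.commute degree_add_eq_left coeff_eq_0)
  moreover have "coeff f k \<in> \<int>" for k
  proof -
    have mult: "\<forall>k. coeff (p * q) k \<in> \<int>" if "\<forall>k. coeff p k \<in> \<int>" "\<forall>k. coeff q k \<in> \<int>" for p q :: "'k poly"
      using that by (auto simp: coeff_mult intro!: Ints_sum Ints_mult)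
    have P: "\<forall>k. coeff (P i j) k \<in> \<int>" for i j
      by (auto simp: P_def coeff_pCons split: nat.split)
    have "\<forall>k. coeff (\<Prod>i\<in>I. P i (p i)) k \<in> \<int>" for p I
      by (induction I rule: infinite_finite_induct)
        (simp_all add: mult P del: coeff_1, simp_all add: coeff_1)
    then have "\<forall>k. coeff (t p) k \<in> \<int>" for p
      by (simp add: t_def sign_def)
    then show ?thesis by (auto simp: f_def coeff_sum intro!: Ints_sum)
  qed
  \<comment> \<open>At \<open>x\<close> the characteristic matrix kills the vector of the
    \<open>\<omega> i\<close>, which is nonzero because \<open>\<omega> i0 = 1\<close>.\<close>
  moreover have "poly f x = 0"
  proof -
    define M :: "'k^'n^'n" where "M = (\<chi> i j. poly (P i j) x)"
    have "poly f x = det M"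
      by (simp add: f_def t_def U_def M_def det_def poly_sum poly_prod sign_def)
    moreover have "M *v (\<chi> i. \<omega> i) = 0"
    proof -
      have "(\<Sum>j\<in>UNIV. poly (P i j) x * \<omega> j) = 0" for i
      proof -
        have "(\<Sum>j\<in>UNIV. poly (P i j) x * \<omega> j)
            = (\<Sum>j\<in>UNIV. (if i = j then x * \<omega> j else 0) - of_int (A i j) * \<omega> j)"
          by (rule sum.cong) (auto simp: P_def algebra_simps)
        also have "\<dots> = 0" by (simp add: sum_subtractf A[rule_format])
        finally show ?thesis .
      qed
      then show ?thesis by (simp add: M_def matrix_vector_mult_def vec_eq_iff)
    qed
    moreover have "(\<chi> i. \<omega> i) \<noteq> 0"
      using one by (metis vec_lambda_beta zero_index zero_neq_one)
    ultimately show ?thesis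
      by (metis invertible_det_nz invertible_left_inverse matrix_left_invertible_ker)
  qed
  ultimately show ?thesis by (intro algebraic_int.intros[of f]) auto
qed

text \<open>The vector \<open>w\<close> of the basis satisfies \<open>A' *v w = x *s w\<close> and
  has entry \<open>1\<close> at \<open>i0\<close>. Cramer's rule at that entry gives
  \<open>det A' = x * det (C w)\<close>, and the cofactor \<open>det (C w)\<close> is built from
  integers and basis elements.\<close>

lemma det_dvd:
  assumes "x \<in> int_span \<omega>"
    and A: "\<And>i. x * \<omega> i = (\<Sum>j\<in>UNIV. of_int (A i j) * \<omega> j)"
  obtains y where "y \<in> int_span \<omega>" "x * y = of_int (det (\<chi> i j. A i j))"
proof -
  define A' :: "'k^'n^'n" where "A' = (\<chi> i j. of_int (A i j))"
  define w :: "'k^'n" where "w = (\<chi> i. \<omega> i)"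
  define C where "C = (\<lambda>v :: 'k^'n. (\<chi> i j. if j = i0 then v $ i else A' $ i $ j) :: 'k^'n^'n)"
  have Aw: "A' *v w = x *s w"
    by (simp add: A'_def w_def matrix_vector_mult_def vector_scalar_mult_def A)
  have "det (C (A' *v w)) = w $ i0 * det A'"
    unfolding C_def by (rule cramer_lemma)
  moreover have "det (C (x *s w)) = x * det (C w)"
  proof -
    have tr: "transpose (C v) = (\<chi> j. if j = i0 then v else (\<chi> i. A' $ i $ j))" for v
      by (simp add: C_def transpose_def vec_eq_iff)
    have "det (transpose (C (x *s w))) = x * det (transpose (C w))"
      unfolding tr by (rule det_row_mul)
    then show ?thesis by simp
  qed
  moreover have "w $ i0 = 1" by (simp add: w_def one)
  ultimately have "x * det (C w) = det A'" by (simp add: Aw)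
  also have "det A' = of_int (det (\<chi> i j. A i j))"
    by (simp add: det_def A'_def)
  finally have "x * det (C w) = of_int (det (\<chi> i j. A i j))" .
  moreover have "det (C w) \<in> int_span \<omega>"
    unfolding det_def C_def
    by (intro int_span_sum int_span_of_int_mult int_span_prod)
      (simp add: A'_def w_def int_span_base int_span_of_int)
  ultimately show ?thesis using that by blast
qed

end

section \<open>An explicit order, the box principle and a unit\<close>

context real_embeddings
begin

text \<open>A rational basis containing \<open>1\<close> is rescaled: every other element is
  multiplied by a common denominator \<open>D\<close> of all structure constants. In a product of
  two rescaled elements one factor \<open>D\<close> makes the structure constants integral, the
  other rescales the basis elements.\<close>

lemma exists_order_basis:
  obtains \<omega> :: "'n \<Rightarrow> 'k" and i0 where "order_basis \<omega> i0"
    and "\<And>x. \<exists>q. x = (\<Sum>i\<in>UNIV. of_rat (q i) * \<omega> i)"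
    and "\<And>m. (\<Sum>i\<in>UNIV. of_int (m i) * \<omega> i) = 0 \<Longrightarrow> m = (\<lambda>_. 0)"
proof -
  define B where "B = ratvs.extend_basis {1 :: 'k}"
  have ind1: "ratvs.independent {1 :: 'k}" by simp
  have B: "ratvs.independent B" "ratvs.span B = UNIV" "1 \<in> B"
    unfolding B_def using ratvs.extend_basis_superset[OF ind1]
    by (auto simp: ratvs.independent_extend_basis[OF ind1] ratvs.span_extend_basis[OF ind1])
  obtain \<beta> :: "'n \<Rightarrow> 'k" where \<beta>: "bij_betw \<beta> UNIV B" using basis_bij[OF B(1,2)] .
  obtain i0 where i0: "\<beta> i0 = 1" using \<beta> B(3) by (metis bij_betw_iff_bijections)
  have inj: "inj \<beta>" using \<beta> by (simp add: bij_betw_def)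
  define r where "r x i = ratvs.representation B x (\<beta> i)" for x i
  have coord: "x = (\<Sum>i\<in>UNIV. of_rat (r x i) * \<beta> i)" for x
    unfolding r_def by (rule span_UNIV_coordinates[OF \<beta> B(1,2)])
  define d where "d = (\<lambda>q::rat. snd (quotient_of q))"
  have d_pos: "d q > 0" for q unfolding d_def by (rule quotient_of_denom_pos')
  have d_int: "\<exists>k. of_int (d q) * q = of_int k" for q
  proof
    obtain a b where ab: "quotient_of q = (a, b)" by fastforce
    then have "q = of_int a / of_int b" "b > 0" by (simp_all add: quotient_of_div quotient_of_denom_pos)
    then show "of_int (d q) * q = of_int (fst (quotient_of q))"
      using ab by (simp add: d_def)
  qed
  define D where "D = (\<Prod>(i, j, k)\<in>(UNIV :: ('n \<times> 'n \<times> 'n) set). d (r (\<beta> i * \<beta> j) k))"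
  have "D > 0" unfolding D_def by (rule prod_pos) (auto simp: d_pos)
  have "\<exists>e. of_int D * r (\<beta> i * \<beta> j) k = of_int e" for i j k
  proof -
    have "d (r (\<beta> i * \<beta> j) k) dvd D"
      unfolding D_def using dvd_prodI[of UNIV "(i,j,k)" "\<lambda>(i, j, k). d (r (\<beta> i * \<beta> j) k)"] by simp
    then obtain e where "D = d (r (\<beta> i * \<beta> j) k) * e" ..
    moreover obtain l where "of_int (d (r (\<beta> i * \<beta> j) k)) * r (\<beta> i * \<beta> j) k = of_int l"
      using d_int by blast
    ultimately have "of_int D * r (\<beta> i * \<beta> j) k = of_int (e * l)"
      by (simp add: mult_ac)
    then show ?thesis by blast
  qed
  then obtain e where e: "\<And>i j k. of_int D * r (\<beta> i * \<beta> j) k = of_int (e i j k)" by metis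
  define \<omega> where "\<omega> i = (if i = i0 then 1 else of_int D * \<beta> i)" for i
  have \<omega>_\<beta>: "of_int D * \<beta> k = of_int (if k = i0 then D else 1) * \<omega> k" for k
    by (simp add: \<omega>_def i0)
  have prod: "\<omega> i * \<omega> j \<in> int_span \<omega>" for i j
  proof (cases "i = i0 \<or> j = i0")
    case True
    then show ?thesis
      using int_span_base[of \<omega> i] int_span_base[of \<omega> j] by (auto simp: \<omega>_def)
  next
    case False
    then have "\<omega> i * \<omega> j = of_int D * of_int D * (\<beta> i * \<beta> j)"
      by (simp add: \<omega>_def mult_ac)
    also have "\<dots> = (\<Sum>k\<in>UNIV. of_int D * of_int D * (of_rat (r (\<beta> i * \<beta> j) k) * \<beta> k))"
      by (subst coord[of "\<beta> i * \<beta> j"]) (simp add: sum_distrib_left)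
    also have "\<dots> = (\<Sum>k\<in>UNIV. of_rat (of_int D * r (\<beta> i * \<beta> j) k) * (of_int D * \<beta> k))"
      by (simp add: of_rat_mult mult_ac)
    also have "\<dots> = (\<Sum>k\<in>UNIV. of_int (e i j k * (if k = i0 then D else 1)) * \<omega> k)"
      by (simp only: e \<omega>_\<beta> of_rat_of_int_eq of_int_mult mult.assoc)
    finally show ?thesis by (rule int_spanI)
  qed
  have "order_basis \<omega> i0"
    by unfold_locales (simp_all add: prod, simp add: \<omega>_def)
  moreover have "\<exists>q. x = (\<Sum>i\<in>UNIV. of_rat (q i) * \<omega> i)" for x
  proof
    have "of_rat (r x i) * \<beta> i = of_rat (if i = i0 then r x i else r x i / of_int D) * \<omega> i" for i
      using \<open>D > 0\<close> by (simp add: \<omega>_def i0 of_rat_divide)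
    then show "x = (\<Sum>i\<in>UNIV. of_rat (if i = i0 then r x i else r x i / of_int D) * \<omega> i)"
      using coord[of x] by simp
  qed
  moreover have "m = (\<lambda>_. 0)" if "(\<Sum>i\<in>UNIV. of_int (m i) * \<omega> i) = 0" for m
  proof -
    \<comment> \<open>The integer relation rewritten over the rational basis \<open>B\<close>, with
      the factor \<open>D\<close> absorbed into the coefficients.\<close>
    define g where "g b = (let i = inv \<beta> b in if i = i0 then of_int (m i) else of_int (m i * D) :: rat)" for b
    have "of_int (m i) * \<omega> i = of_rat (g (\<beta> i)) * \<beta> i" for i
      by (simp add: g_def \<omega>_def i0 inj Let_def of_rat_mult)
    then have "(\<Sum>i\<in>UNIV. of_rat (g (\<beta> i)) * \<beta> i) = 0" using that by simp
    then have "(\<Sum>b\<in>B. of_rat (g b) * b) = 0"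
      using sum.reindex_bij_betw[OF \<beta>, of "\<lambda>b. of_rat (g b) * b"] by simp
    moreover have "finite B" using bij_betw_finite[OF \<beta>] by simp
    ultimately have "g b = 0" if "b \<in> B" for b
      using ratvs.independentD[OF B(1), of B g b] that by simp
    moreover have "\<beta> i \<in> B" for i using \<beta> by (auto simp: bij_betw_def)
    ultimately have g0: "g (\<beta> i) = 0" for i by blast
    have "m i = 0" for i
      using g0[of i] \<open>D > 0\<close> by (auto simp: g_def inj Let_def split: if_splits)
    then show ?thesis by blast
  qed
  ultimately show ?thesis using that by blast
qed

text \<open>
  Dirichlet's box argument with coordinates up to \<open>q ^ (n - 1)\<close> and, in each embedding except
  \<open>j1\<close>, \<open>q ^ n\<close> boxes: the smallness in these embeddings compensates the size in \<open>j1\<close>.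
\<close>

lemma small_norm_element:
  fixes \<omega> :: "'n \<Rightarrow> 'k" and q :: nat
  assumes ind: "\<And>m. (\<Sum>i\<in>UNIV. of_int (m i) * \<omega> i) = 0 \<Longrightarrow> m = (\<lambda>_. 0)"
    and L: "L > 0" "\<And>j. (\<Sum>i\<in>UNIV. \<bar>\<sigma> j (\<omega> i)\<bar>) < L"
    and q: "q > 0"
  obtains x where "x \<in> int_span \<omega>" "x \<noteq> 0" "\<bar>\<Prod>j\<in>UNIV. \<sigma> j x\<bar> \<le> (2 * L) ^ CARD('n)"
    and "\<And>j. j \<noteq> j1 \<Longrightarrow> \<bar>\<sigma> j x\<bar> \<le> 2 * L / q"
proof -
  define n where "n = CARD('n)"
  have "n \<ge> 1" by (simp add: n_def Suc_leI)
  \<comment> \<open>With these exponents there are \<open>h ^ (n - 1) = Q ^ n\<close> boxes, fewer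
    than the \<open>(Q + 1) ^ n\<close> coordinate vectors.\<close>
  define Q h where "Q = q ^ (n - 1)" and "h = q ^ n"
  have Qh: "Q > 0" "h > 0" using q by (simp_all add: Q_def h_def)
  have hQ: "h = q * Q" using \<open>n \<ge> 1\<close> by (simp add: h_def Q_def power_eq_if)
  define y where "y m = (\<Sum>i\<in>UNIV. of_nat (m i) * \<omega> i)" for m :: "'n \<Rightarrow> nat"
  define PM where "PM = (UNIV :: 'n set) \<rightarrow>\<^sub>E {..Q}"
  \<comment> \<open>In each embedding the range of length \<open>2 * L * Q\<close> is cut into
    \<open>h\<close> pieces of length \<open>2 * L * Q / h = 2 * L / q\<close>.\<close>
  define bucket where "bucket m = (\<lambda>j\<in>UNIV - {j1}. nat \<lfloor>(\<sigma> j (y m) + L * Q) * h / (2 * L * Q)\<rfloor>)" for m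
  have ybound: "\<bar>\<sigma> j (y m)\<bar> < L * Q" if "m \<in> PM" for m j
  proof -
    have "\<bar>\<sigma> j (y m)\<bar> \<le> (\<Sum>i\<in>UNIV. \<bar>of_nat (m i) * \<sigma> j (\<omega> i)\<bar>)"
      unfolding y_def emb_simps by (rule sum_abs)
    also have "\<dots> \<le> (\<Sum>i\<in>UNIV. Q * \<bar>\<sigma> j (\<omega> i)\<bar>)"
      using that by (intro sum_mono) (auto simp: PM_def abs_mult PiE_iff intro!: mult_right_mono)
    also have "\<dots> < L * Q"
      using L(2)[of j] Qh by (simp add: sum_distrib_left[symmetric] mult.commute)
    finally show ?thesis .
  qed
  have bucket_less: "nat \<lfloor>(\<sigma> j (y m) + L * Q) * h / (2 * L * Q)\<rfloor> < h" if m: "m \<in> PM" for m j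
  proof -
    have "(\<sigma> j (y m) + L * Q) * h < (2 * L * Q) * h"
      using ybound[OF m, of j] Qh by (intro mult_strict_right_mono) auto
    then have "(\<sigma> j (y m) + L * Q) * h / (2 * L * Q) < h"
      using L Qh by (simp add: divide_less_eq mult_ac)
    then have "\<lfloor>(\<sigma> j (y m) + L * Q) * h / (2 * L * Q)\<rfloor> < int h"
      by (simp add: floor_less_iff)
    then show ?thesis
      using Qh by (simp add: nat_less_iff)
  qed
  have "bucket ` PM \<subseteq> (UNIV - {j1}) \<rightarrow>\<^sub>E {..<h}"
    unfolding bucket_def
    by (intro image_subsetI, unfold restrict_PiE_iff) (intro ballI lessThan_iff[THEN iffD2] bucket_less)
  then have "card (bucket ` PM) \<le> card ((UNIV - {j1}) \<rightarrow>\<^sub>E {..<h})"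
    by (intro card_mono finite_PiE) auto
  also have "\<dots> = h ^ (n - 1)" by (simp add: card_funcsetE n_def card_Diff_singleton)
  also have "\<dots> = Q ^ n" by (simp add: h_def Q_def mult.commute flip: power_mult)
  also have "\<dots> < (Q + 1) ^ n" using \<open>n \<ge> 1\<close> by (intro power_strict_mono) auto
  also have "\<dots> = card PM" by (simp add: PM_def card_funcsetE n_def)
  finally have "\<not> inj_on bucket PM" by (rule pigeonhole)
  then obtain m m' where m: "m \<in> PM" "m' \<in> PM" "m \<noteq> m'" "bucket m = bucket m'"
    by (auto simp: inj_on_def)
  define x where "x = y m - y m'"
  have x: "x = (\<Sum>i\<in>UNIV. of_int (int (m i) - int (m' i)) * \<omega> i)"
    by (simp add: x_def y_def algebra_simps sum_subtractf)
  have "x \<in> int_span \<omega>" by (rule int_spanI[OF x])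
  moreover have "x \<noteq> 0"
    using ind[of "\<lambda>i. int (m i) - int (m' i)"] m(3) by (auto simp: x fun_eq_iff)
  moreover have small: "\<bar>\<sigma> j x\<bar> \<le> 2 * L / q" if "j \<noteq> j1" for j
  proof -
    define u where "u m = (\<sigma> j (y m) + L * Q) * h / (2 * L * Q)" for m
    have nonneg: "u m \<ge> 0" if "m \<in> PM" for m
      using ybound[OF that, of j] L Qh by (simp add: u_def)
    have "nat \<lfloor>u m\<rfloor> = nat \<lfloor>u m'\<rfloor>"
      using fun_cong[OF m(4), of j] \<open>j \<noteq> j1\<close> by (simp add: bucket_def u_def)
    then have "\<lfloor>u m\<rfloor> = \<lfloor>u m'\<rfloor>"
      using nonneg[OF m(1)] nonneg[OF m(2)] eq_nat_nat_iff[of "\<lfloor>u m\<rfloor>" "\<lfloor>u m'\<rfloor>"] by simp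
    then have "\<bar>u m - u m'\<bar> < 1" by linarith
    moreover have "u m - u m' = \<sigma> j x * h / (2 * L * Q)"
      by (simp add: u_def x_def emb_simps diff_divide_distrib[symmetric] algebra_simps)
    also have "\<dots> = \<sigma> j x * (q / (2 * L))"
      using Qh by (simp add: hQ)
    finally have "\<bar>\<sigma> j x\<bar> * (q / (2 * L)) < 1"
      using L q by (simp add: abs_mult)
    then show ?thesis using L q by (simp add: field_simps)
  qed
  \<comment> \<open>The \<open>n - 1\<close> small factors contribute
    \<open>1 / q ^ (n - 1) = 1 / Q\<close>. This cancels the \<open>Q\<close> of the large one, so
    the bound is independent of \<open>q\<close>.\<close>
  moreover have "\<bar>\<Prod>j\<in>UNIV. \<sigma> j x\<bar> \<le> (2 * L) ^ CARD('n)"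
  proof -
    have big: "\<bar>\<sigma> j1 x\<bar> \<le> 2 * L * Q"
      using ybound[OF m(1), of j1] ybound[OF m(2), of j1] by (simp add: x_def emb_simps)
    have "\<bar>\<Prod>j\<in>UNIV. \<sigma> j x\<bar> = \<bar>\<sigma> j1 x\<bar> * (\<Prod>j\<in>UNIV - {j1}. \<bar>\<sigma> j x\<bar>)"
      by (simp add: prod.remove[of UNIV j1] abs_mult abs_prod)
    also have "\<dots> \<le> (2 * L * Q) * (\<Prod>j\<in>UNIV - {j1}. 2 * L / q)"
      using big small by (intro mult_mono prod_mono prod_nonneg) (auto simp: L less_imp_le)
    also have "\<dots> = (2 * L * Q) * ((2 * L) ^ (n - 1) / Q)"
      by (simp add: card_Diff_singleton n_def[symmetric] power_divide Q_def)
    also have "\<dots> = (2 * L) ^ n"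
      using Qh \<open>n \<ge> 1\<close> by (simp add: power_eq_if)
    finally show ?thesis by (simp add: n_def)
  qed
  ultimately show ?thesis using that by blast
qed

text \<open>In a finite set of nonzero elements the values in a second embedding \<open>j2\<close>
  would be bounded away from \<open>0\<close>, but the box argument with large \<open>q\<close>
  produces an element of the set with a smaller value there. The norm bound does not change with
  \<open>q\<close>.\<close>

lemma infinite_small_norm:
  fixes \<omega> :: "'n \<Rightarrow> 'k"
  assumes ind: "\<And>m. (\<Sum>i\<in>UNIV. of_int (m i) * \<omega> i) = 0 \<Longrightarrow> m = (\<lambda>_. 0)"
    and card: "CARD('n) \<ge> 2"
  obtains C :: real where "infinite {x \<in> int_span \<omega>. x \<noteq> 0 \<and> \<bar>\<Prod>j\<in>UNIV. \<sigma> j x\<bar> \<le> C}"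
proof -
  define L where "L = 1 + (\<Sum>j\<in>UNIV. \<Sum>i\<in>UNIV. \<bar>\<sigma> j (\<omega> i)\<bar>)"
  have "0 \<le> (\<Sum>j\<in>UNIV. \<Sum>i\<in>UNIV. \<bar>\<sigma> j (\<omega> i)\<bar>)" by (intro sum_nonneg) simp
  then have "L > 0" by (simp add: L_def)
  have L: "(\<Sum>i\<in>UNIV. \<bar>\<sigma> j (\<omega> i)\<bar>) < L" for j
    using member_le_sum[of j UNIV "\<lambda>j. \<Sum>i\<in>UNIV. \<bar>\<sigma> j (\<omega> i)\<bar>"] by (simp add: L_def sum_nonneg)
  define C where "C = (2 * L) ^ CARD('n)"
  define X where "X = {x \<in> int_span \<omega>. x \<noteq> 0 \<and> \<bar>\<Prod>j\<in>UNIV. \<sigma> j x\<bar> \<le> C}"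
  obtain j1 j2 :: 'n where "j2 \<noteq> j1"
    using card by (metis card_2_iff' card_le_Suc0_iff_eq finite not_less_eq_eq numeral_2_eq_2 UNIV_I)
  have "infinite X"
  proof
    assume "finite X"
    \<comment> \<open>The default \<open>1\<close> keeps the minimum defined should \<open>X\<close>
      be empty.\<close>
    define \<delta> where "\<delta> = Min (insert 1 ((\<lambda>x. \<bar>\<sigma> j2 x\<bar>) ` X))"
    have "\<delta> > 0" unfolding \<delta>_def using \<open>finite X\<close>
      by (subst Min_gr_iff) (auto simp: X_def emb_simps)
    obtain q :: nat where q: "q > 2 * L / \<delta>" using reals_Archimedean2 by blast
    then have "q > 0" using \<open>\<delta> > 0\<close> \<open>L > 0\<close> by (metis divide_pos_pos less_trans of_nat_0_less_iff zero_less_mult_iff zero_less_numeral)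
    obtain x where x: "x \<in> int_span \<omega>" "x \<noteq> 0" "\<bar>\<Prod>j\<in>UNIV. \<sigma> j x\<bar> \<le> C"
      "\<And>j. j \<noteq> j1 \<Longrightarrow> \<bar>\<sigma> j x\<bar> \<le> 2 * L / q"
      using small_norm_element[OF ind \<open>L > 0\<close> L \<open>q > 0\<close>, of j1] unfolding C_def by metis
    then have "x \<in> X" by (simp add: X_def)
    then have "\<delta> \<le> \<bar>\<sigma> j2 x\<bar>" unfolding \<delta>_def using \<open>finite X\<close> by (intro Min_le) auto
    also have "\<dots> \<le> 2 * L / q" using x(4) \<open>j2 \<noteq> j1\<close> .
    also have "\<dots> < \<delta>" using q \<open>\<delta> > 0\<close> \<open>q > 0\<close> by (simp add: field_simps)
    finally show False by simp
  qed
  then show ?thesis using that[of C] by (simp add: X_def)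
qed

text \<open>
  Two elements \<open>a\<close>, \<open>b\<close> of equal norm \<open>N\<close> that are congruent modulo \<open>4 * N\<close> have a quotient that is
  a unit congruent to \<open>1\<close> modulo \<open>4\<close>, because both divide \<open>N\<close>.
\<close>

lemma exists_unit_cong_1_mod_4:
  assumes card: "CARD('n) \<ge> 2"
  obtains M :: "'k set" and u :: 'k
  where "M \<subseteq> ring_of_integers" "1 \<in> M" "\<And>x y. x \<in> M \<Longrightarrow> y \<in> M \<Longrightarrow> x + y \<in> M"
    "\<And>x y. x \<in> M \<Longrightarrow> y \<in> M \<Longrightarrow> x * y \<in> M" "\<And>x. x \<in> M \<Longrightarrow> - x \<in> M"
    "u \<noteq> 0" "u \<noteq> 1" "u \<noteq> - 1" "(u - 1) / 4 \<in> M" "(1 / u - 1) / 4 \<in> M"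
proof -
  obtain \<omega> :: "'n \<Rightarrow> 'k" and i0 where ob: "order_basis \<omega> i0"
    and span: "\<And>x. \<exists>q. x = (\<Sum>i\<in>UNIV. of_rat (q i) * \<omega> i)"
    and ind: "\<And>m. (\<Sum>i\<in>UNIV. of_int (m i) * \<omega> i) = 0 \<Longrightarrow> m = (\<lambda>_. 0)"
    using exists_order_basis by blast
  interpret order_basis \<omega> i0 by (rule ob)
  obtain C where inf: "infinite {x \<in> int_span \<omega>. x \<noteq> 0 \<and> \<bar>\<Prod>j\<in>UNIV. \<sigma> j x\<bar> \<le> C}"
    using infinite_small_norm[OF ind card] by blast
  define X where "X = {x \<in> int_span \<omega>. x \<noteq> 0 \<and> \<bar>\<Prod>j\<in>UNIV. \<sigma> j x\<bar> \<le> C}"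
  have norm: "\<exists>N::int. real_of_int N = (\<Prod>j\<in>UNIV. \<sigma> j x) \<and> (\<exists>y\<in>int_span \<omega>. x * y = of_int N)"
    if x: "x \<in> int_span \<omega>" for x
  proof -
    obtain A where A: "\<forall>i. x * \<omega> i = (\<Sum>j\<in>UNIV. of_int (A i j) * \<omega> j)"
      using multiplication_matrix[OF x] .
    obtain y where "y \<in> int_span \<omega>" "x * y = of_int (det (\<chi> i j. A i j))"
      using det_dvd[OF x A[rule_format]] .
    moreover have "det (\<chi> i j. real_of_rat (of_int (A i j))) = (\<Prod>j\<in>UNIV. \<sigma> j x)"
      by (rule trace_det_multiplication_matrix(2)[OF span]) (simp add: A[rule_format])
    then have "real_of_int (det (\<chi> i j. A i j)) = (\<Prod>j\<in>UNIV. \<sigma> j x)"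
      by (simp add: det_def)
    ultimately show ?thesis by blast
  qed
  then obtain N where N: "\<And>x. x \<in> int_span \<omega> \<Longrightarrow> real_of_int (N x) = (\<Prod>j\<in>UNIV. \<sigma> j x)"
    "\<And>x. x \<in> int_span \<omega> \<Longrightarrow> \<exists>y\<in>int_span \<omega>. x * y = of_int (N x)" by metis
  have N0: "N x \<noteq> 0" if "x \<in> X" for x
  proof -
    have "real_of_int (N x) \<noteq> 0" using that by (simp add: X_def N(1) emb_simps)
    then show ?thesis by simp
  qed
  have "N ` X \<subseteq> {- \<lceil>C\<rceil>..\<lceil>C\<rceil>}"
  proof clarsimp
    fix x assume "x \<in> X"
    then have "\<bar>real_of_int (N x)\<bar> \<le> C" by (simp add: X_def N(1))
    then show "- \<lceil>C\<rceil> \<le> N x \<and> N x \<le> \<lceil>C\<rceil>" by linarith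
  qed
  then have "finite (N ` X)" by (rule finite_subset) simp
  then obtain N0 where "N0 \<noteq> 0" and inf1: "infinite {x \<in> X. N x = N0}"
    using pigeonhole_infinite[of X N] inf N0 unfolding X_def[symmetric] by blast
  define d where "d = 4 * \<bar>N0\<bar>"
  have "d > 0" using \<open>N0 \<noteq> 0\<close> by (simp add: d_def)
  have "\<forall>x\<in>int_span \<omega>. \<exists>m. x = (\<Sum>i\<in>UNIV. of_int (m i) * \<omega> i)" by (auto simp: int_span_def)
  then obtain m where m: "\<And>x. x \<in> int_span \<omega> \<Longrightarrow> x = (\<Sum>i\<in>UNIV. of_int (m x i) * \<omega> i)" by metis
  define res where "res x = (\<lambda>i. m x i mod d)" for x
  have "res ` {x \<in> X. N x = N0} \<subseteq> UNIV \<rightarrow>\<^sub>E {0..<d}"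
    using \<open>d > 0\<close> by (auto simp: res_def)
  then have "finite (res ` {x \<in> X. N x = N0})"
    by (rule finite_subset) (intro finite_PiE; simp)
  then obtain a where a: "a \<in> X" "N a = N0" and inf2: "infinite {x \<in> X. N x = N0 \<and> res x = res a}"
    using pigeonhole_infinite[OF inf1, of res] by (auto simp: conj_assoc)
  \<comment> \<open>Infinitely many candidates remain, so \<open>a\<close> and \<open>- a\<close>
    can be avoided; this makes the unit \<open>a / b\<close> different from \<open>1\<close> and
    \<open>- 1\<close>.\<close>
  obtain b where b: "b \<in> X" "N b = N0" "res b = res a" "b \<noteq> a" "b \<noteq> - a"
  proof -
    have "infinite ({x \<in> X. N x = N0 \<and> res x = res a} - {a, - a})"
      using inf2 by (rule Diff_infinite_finite[rotated]) simp
    then obtain b where "b \<in> {x \<in> X. N x = N0 \<and> res x = res a} - {a, - a}"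
      using infinite_imp_nonempty by blast
    then show ?thesis using that by blast
  qed
  have ab: "a \<in> int_span \<omega>" "b \<in> int_span \<omega>" "a \<noteq> 0" "b \<noteq> 0"
    using a b by (simp_all add: X_def)
  obtain a' b' where a': "a' \<in> int_span \<omega>" "a * a' = of_int N0" and b': "b' \<in> int_span \<omega>" "b * b' = of_int N0"
    using N(2)[OF ab(1)] N(2)[OF ab(2)] a b by auto
  define g where "g = (\<Sum>i\<in>UNIV. of_int ((m a i - m b i) div d) * \<omega> i)"
  have g: "g \<in> int_span \<omega>" unfolding g_def by (rule int_spanI) simp
  have "a - b = of_int d * g"
  proof -
    have "d dvd m a i - m b i" for i
      using fun_cong[OF b(3), of i] by (simp add: res_def mod_eq_dvd_iff dvd_diff_commute)
    then have "of_int (m a i - m b i) = (of_int d * of_int ((m a i - m b i) div d) :: 'k)" for i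
      by (simp flip: of_int_mult)
    moreover have "a - b = (\<Sum>i\<in>UNIV. of_int (m a i) * \<omega> i) - (\<Sum>i\<in>UNIV. of_int (m b i) * \<omega> i)"
      by (rule arg_cong2[where f = "(-)", OF m[OF ab(1)] m[OF ab(2)]])
    then have "a - b = (\<Sum>i\<in>UNIV. of_int (m a i - m b i) * \<omega> i)"
      by (simp add: left_diff_distrib sum_subtractf)
    ultimately have "a - b = (\<Sum>i\<in>UNIV. of_int d * of_int ((m a i - m b i) div d) * \<omega> i)"
      by simp
    then show ?thesis by (simp add: g_def sum_distrib_left mult.assoc)
  qed
  \<comment> \<open>The sign turns \<open>\<bar>N0\<bar>\<close> into \<open>N0\<close>, which
    equals both \<open>b * b'\<close> and \<open>a * a'\<close>. Dividing \<open>a - b\<close> by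
    \<open>b\<close> or by \<open>a\<close> then leaves \<open>4\<close> times an element of the
    order.\<close>
  define s where "s = sgn N0"
  have "d = 4 * s * N0" by (simp add: d_def s_def abs_sgn mult.commute)
  have diff: "a - b = 4 * of_int s * of_int N0 * g"
    using \<open>a - b = of_int d * g\<close> \<open>d = 4 * s * N0\<close> by simp
  show ?thesis
  proof (rule that[of "int_span \<omega>" "a / b"])
    show "int_span \<omega> \<subseteq> ring_of_integers"
      by (auto simp: ring_of_integers_def algebraic_int_int_span)
    have "(a / b - 1) / 4 = of_int s * (b' * g)"
      using diff ab by (simp add: field_simps flip: b'(2))
    then show "(a / b - 1) / 4 \<in> int_span \<omega>"
      using g b' by (simp add: int_span_mult int_span_of_int_mult)
    have "(1 / (a / b) - 1) / 4 = of_int (- s) * (a' * g)"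
      using diff ab by (simp add: field_simps flip: a'(2))
    then show "(1 / (a / b) - 1) / 4 \<in> int_span \<omega>"
      using g a' int_span_of_int_mult[of "a' * g" \<omega> "- s"] by (simp add: int_span_mult)
  qed (use ab b in \<open>auto simp: int_span_1 int_span_add int_span_mult int_span_minus field_simps\<close>)
qed

end

section \<open>Fourier transforms of Gaussians\<close>

lemma integrable_real_gaussian:
  fixes a :: real
  assumes "a > 0"
  shows "integrable lborel (\<lambda>x::real. exp (- (a * x\<^sup>2)))"
proof -
  define s where "s = sqrt (1 / (2 * a))"
  have s: "s > 0" "s\<^sup>2 = 1 / (2 * a)" using assms by (simp_all add: s_def)
  have "exp (- (a * x\<^sup>2)) = sqrt (2 * pi * s\<^sup>2) * normal_density 0 s x" for x
    using assms s by (simp add: normal_density_def field_simps)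
  then show ?thesis using integrable_normal_density[of s 0] s by simp
qed

text \<open>This is the characteristic function of the standard normal distribution at
  \<open>s\<close>, after the substitution by the factor \<open>c\<close>, which turns the variance
  \<open>1\<close> into \<open>1 / (2 * pi * t)\<close>.\<close>

lemma integral_gaussian_iexp_real:
  fixes t \<xi> :: real
  assumes "t > 0"
  shows "(LINT x|lborel. exp (- of_real pi * of_real t * (of_real x)\<^sup>2 - 2 * of_real pi * \<i> * of_real x * of_real \<xi>))
       = complex_of_real (exp (- pi * \<xi>\<^sup>2 / t) / sqrt t)"
proof -
  define c where "c = sqrt (2 * pi * t)"
  define s where "s = - 2 * pi * \<xi> / c"
  have c: "c > 0" "c\<^sup>2 = 2 * pi * t" using assms by (simp_all add: c_def)
  have "complex_of_real (exp (- (s\<^sup>2) / 2)) = (LINT x|lborel. std_normal_density x *\<^sub>R iexp (s * x))"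
    using fun_cong[OF char_std_normal_distribution, of s]
    by (simp add: char_def integral_density)
  also have "\<dots> = c *\<^sub>R (LINT x|lborel. std_normal_density (c * x) *\<^sub>R iexp (s * (c * x)))"
    using lborel_integral_real_affine[of c "\<lambda>x. std_normal_density x *\<^sub>R iexp (s * x)" 0] c by simp
  also have "(\<lambda>x. std_normal_density (c * x) *\<^sub>R iexp (s * (c * x)))
      = (\<lambda>x. (1 / sqrt (2 * pi)) *\<^sub>R exp (- of_real pi * of_real t * (of_real x)\<^sup>2 - 2 * of_real pi * \<i> * of_real x * of_real \<xi>))"
  proof
    fix x
    have "std_normal_density (c * x) = exp (- pi * t * x\<^sup>2) / sqrt (2 * pi)"
      using c by (simp add: normal_density_def power_mult_distrib)
    moreover have "s * (c * x) = - 2 * pi * x * \<xi>" using c by (simp add: s_def)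
    moreover have "exp (- of_real pi * of_real t * (of_real x)\<^sup>2 - 2 * of_real pi * \<i> * of_real x * of_real \<xi>)
        = complex_of_real (exp (- pi * t * x\<^sup>2)) * iexp (- 2 * pi * x * \<xi>)"
      by (simp add: exp_of_real[symmetric] exp_add[symmetric] mult_ac)
    ultimately show "std_normal_density (c * x) *\<^sub>R iexp (s * (c * x))
      = (1 / sqrt (2 * pi)) *\<^sub>R exp (- of_real pi * of_real t * (of_real x)\<^sup>2 - 2 * of_real pi * \<i> * of_real x * of_real \<xi>)"
      by (simp only: scaleR_conv_of_real) simp
  qed
  also have "c *\<^sub>R (LINT x|lborel. (1 / sqrt (2 * pi)) *\<^sub>R exp (- of_real pi * of_real t * (of_real x)\<^sup>2 - 2 * of_real pi * \<i> * of_real x * of_real \<xi>))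
     = sqrt t *\<^sub>R (LINT x|lborel. exp (- of_real pi * of_real t * (of_real x)\<^sup>2 - 2 * of_real pi * \<i> * of_real x * of_real \<xi>))"
    by (simp add: c_def real_sqrt_mult)
  finally have "sqrt t *\<^sub>R (LINT x|lborel. exp (- of_real pi * of_real t * (of_real x)\<^sup>2 - 2 * of_real pi * \<i> * of_real x * of_real \<xi>))
     = complex_of_real (exp (- (s\<^sup>2) / 2))" by simp
  moreover have "s\<^sup>2 = 4 * pi\<^sup>2 * \<xi>\<^sup>2 / (2 * pi * t)"
    unfolding c(2)[symmetric] by (simp add: s_def power_divide power_mult_distrib)
  then have "- (s\<^sup>2) / 2 = - pi * \<xi>\<^sup>2 / t"
    using assms by (simp add: power2_eq_square field_simps)
  ultimately show ?thesis
    using assms by (simp add: scaleR_conv_of_real field_simps)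
qed

context
  fixes \<xi> :: real
begin

private definition f :: "complex \<Rightarrow> real \<Rightarrow> complex" where
  "f w x = exp (- of_real pi * w * (of_real x)\<^sup>2 - 2 * of_real pi * \<i> * of_real x * of_real \<xi>)"

private lemma norm_f: "norm (f w x) = exp (- (pi * Re w * x\<^sup>2))"
  by (simp add: f_def flip: of_real_power)

private lemma f_measurable [measurable]: "f w \<in> borel_measurable borel"
  unfolding f_def by measurable

private lemma f_integrable: "Re w > 0 \<Longrightarrow> integrable lborel (f w)"
  by (rule Bochner_Integration.integrable_bound[OF integrable_real_gaussian[of "pi * Re w"]])
    (simp_all add: norm_f)

text \<open>The integrals over \<open>[-n, n]\<close> are holomorphic by differentiation under the
  integral sign, and they converge locally uniformly.\<close>

private lemma holomorphic_integral_f: "(\<lambda>w. LINT x|lborel. f w x) holomorphic_on {w. Re w > 0}"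
proof (rule holomorphic_uniform_sequence)
  show "open {w. Re w > 0}" by (rule open_halfspace_Re_gt)
  show "(\<lambda>w. integral (cbox (- real n) (real n)) (f w)) holomorphic_on {w. Re w > 0}" for n
  proof (rule leibniz_rule_holomorphic)
    show "((\<lambda>w. f w t) has_field_derivative (- of_real pi * (of_real t)\<^sup>2 * f w t)) (at w within {w. Re w > 0})" for w t
      unfolding f_def by (auto intro!: derivative_eq_intros)
    show "f w integrable_on cbox (- real n) (real n)" for w
      unfolding f_def by (intro integrable_continuous continuous_intros)
    show "continuous_on ({w. 0 < Re w} \<times> cbox (- real n) (real n)) (\<lambda>(w, t). - of_real pi * (of_real t)\<^sup>2 * f w t)"
      unfolding f_def split_def by (intro continuous_intros)
    show "convex {w. 0 < Re w}" by (rule convex_halfspace_Re_gt)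
  qed
  fix w0 :: complex
  assume "w0 \<in> {w. Re w > 0}"
  \<comment> \<open>With half of \<open>Re w0\<close> as radius, the same number is a lower bound
    for \<open>Re w\<close> on the disc.\<close>
  define \<delta> where "\<delta> = Re w0 / 2"
  have \<delta>: "\<delta> > 0" using \<open>w0 \<in> _\<close> by (simp add: \<delta>_def)
  have Re_ge: "Re w \<ge> \<delta>" if "w \<in> cball w0 \<delta>" for w
  proof -
    have "\<bar>Re (w0 - w)\<bar> \<le> norm (w0 - w)" by (rule abs_Re_le_cmod)
    also have "\<dots> \<le> \<delta>" using that by (simp add: dist_norm)
    finally show ?thesis unfolding \<delta>_def minus_complex.sel by linarith
  qed
  \<comment> \<open>The tail of the Gaussian with the smallest admissible decay; it dominates the
    truncation error uniformly on the disc.\<close>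
  define T where "T n = (LINT x|lborel. indicator (- {- real n..real n}) x *\<^sub>R exp (- (pi * \<delta> * x\<^sup>2)))" for n
  have T_integrable: "integrable lborel (\<lambda>x::real. indicator (- {- real n..real n}) x *\<^sub>R exp (- (pi * \<delta> * x\<^sup>2)))" for n
    using \<delta> by (intro integrable_mult_indicator integrable_real_gaussian) auto
  have "T \<longlonglongrightarrow> (LINT x|(lborel :: real measure). 0)"
    unfolding T_def
  proof (rule integral_dominated_convergence[where w = "\<lambda>x::real. exp (- (pi * \<delta> * x\<^sup>2))"])
    show "integrable lborel (\<lambda>x::real. exp (- (pi * \<delta> * x\<^sup>2)))"
      using \<delta> by (intro integrable_real_gaussian) simp
    show "AE x in lborel. (\<lambda>n. indicator (- {- real n..real n}) x *\<^sub>R exp (- (pi * \<delta> * x\<^sup>2))) \<longlonglongrightarrow> 0"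
    proof (intro AE_I2 tendsto_eventually)
      fix x :: real
      obtain N where "\<bar>x\<bar> \<le> real N" using real_arch_simple by blast
      then show "\<forall>\<^sub>F n in sequentially. indicator (- {- real n..real n}) x *\<^sub>R exp (- (pi * \<delta> * x\<^sup>2)) = 0"
        by (intro eventually_sequentiallyI[of N]) (auto simp: indicator_def)
    qed
  qed (auto simp: indicator_def)
  then have T: "T \<longlonglongrightarrow> 0" by simp
  have bound: "norm (integral (cbox (- real n) (real n)) (f w) - (LINT x|lborel. f w x)) \<le> T n"
    if "w \<in> cball w0 \<delta>" for w n
  proof -
    have w: "Re w > 0" using Re_ge[OF that] \<delta> by simp
    note int = f_integrable[OF w]
    have int_ind: "integrable lborel (\<lambda>x. indicator {- real n..real n} x *\<^sub>R f w x)"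
      by (rule integrable_mult_indicator[OF _ int]) simp
    have "integral {- real n..real n} (f w) = (LINT x:{- real n..real n}|lborel. f w x)"
      by (rule set_borel_integral_eq_integral(2)[symmetric]) (unfold set_integrable_def, rule int_ind)
    then have "integral (cbox (- real n) (real n)) (f w) - (LINT x|lborel. f w x)
       = (LINT x|lborel. indicator {- real n..real n} x *\<^sub>R f w x - f w x)"
      unfolding set_lebesgue_integral_def cbox_interval Bochner_Integration.integral_diff[OF int_ind int]
      by simp
    also have "norm \<dots> \<le> T n"
      unfolding T_def
    proof (rule Bochner_Integration.integral_norm_bound_integral)
      show "integrable lborel (\<lambda>x. indicator {- real n..real n} x *\<^sub>R f w x - f w x)"
        by (rule Bochner_Integration.integrable_diff[OF int_ind int])
      show "norm (indicator {- real n..real n} x *\<^sub>R f w x - f w x)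
        \<le> indicator (- {- real n..real n}) x *\<^sub>R exp (- (pi * \<delta> * x\<^sup>2))" for x
      proof -
        have "pi * \<delta> * x\<^sup>2 \<le> pi * Re w * x\<^sup>2"
          using Re_ge[OF that] by (intro mult_right_mono mult_left_mono) simp_all
        then show ?thesis by (simp add: indicator_def norm_f)
      qed
    qed (rule T_integrable)
    finally show ?thesis .
  qed
  show "\<exists>d>0. cball w0 d \<subseteq> {w. 0 < Re w} \<and>
      uniform_limit (cball w0 d) (\<lambda>n w. integral (cbox (- real n) (real n)) (f w)) (\<lambda>w. LINT x|lborel. f w x) sequentially"
  proof (intro exI conjI)
    show "cball w0 \<delta> \<subseteq> {w. 0 < Re w}" by (intro subsetI CollectI less_le_trans[OF \<delta> Re_ge])
    show "uniform_limit (cball w0 \<delta>) (\<lambda>n w. integral (cbox (- real n) (real n)) (f w)) (\<lambda>w. LINT x|lborel. f w x) sequentially"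
    proof (rule uniform_limitI)
      fix e :: real assume "e > 0"
      then have "\<forall>\<^sub>F n in sequentially. T n < e" by (rule order_tendstoD(2)[OF T])
      then show "\<forall>\<^sub>F n in sequentially. \<forall>w\<in>cball w0 \<delta>.
          dist (integral (cbox (- real n) (real n)) (f w)) (LINT x|lborel. f w x) < e"
      proof eventually_elim
        case (elim n)
        show ?case
          unfolding dist_norm by (intro ballI le_less_trans[OF bound elim])
      qed
    qed
  qed (rule \<delta>)
qed

text \<open>Both sides of the formula are holomorphic on the right half plane, where the principal
  root has no branch cut, and they agree on the positive real axis.\<close>

lemma fourier_gaussian_real_line:
  assumes "Re w > 0"
  shows "integrable lborel (\<lambda>x. exp (- of_real pi * w * (of_real x)\<^sup>2 - 2 * of_real pi * \<i> * of_real x * of_real \<xi>))"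
    and "(LINT x|lborel. exp (- of_real pi * w * (of_real x)\<^sup>2 - 2 * of_real pi * \<i> * of_real x * of_real \<xi>))
      = exp (- of_real pi * (of_real \<xi>)\<^sup>2 / w) / csqrt w"
proof -
  show "integrable lborel (\<lambda>x. exp (- of_real pi * w * (of_real x)\<^sup>2 - 2 * of_real pi * \<i> * of_real x * of_real \<xi>))"
    using f_integrable[OF assms] unfolding f_def[abs_def] .
  define S where "S = {w. Re w > 0}"
  have "(LINT x|lborel. f w x) - exp (- of_real pi * (of_real \<xi>)\<^sup>2 / w) / csqrt w = 0"
  proof (rule analytic_continuation[where f = "\<lambda>w. (LINT x|lborel. f w x) - exp (- of_real pi * (of_real \<xi>)\<^sup>2 / w) / csqrt w"
        and S = S and U = "of_real ` {0<..}" and \<xi> = 1])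
    have "w \<notin> \<real>\<^sub>\<le>\<^sub>0" if "w \<in> S" for w
      using that by (auto simp: S_def complex_nonpos_Reals_iff)
    then show "(\<lambda>w. (LINT x|lborel. f w x) - exp (- of_real pi * (of_real \<xi>)\<^sup>2 / w) / csqrt w) holomorphic_on S"
      by (intro holomorphic_intros holomorphic_integral_f[folded S_def]) (auto simp: S_def)
    show "open S" unfolding S_def by (rule open_halfspace_Re_gt)
    show "connected S" unfolding S_def by (intro convex_connected convex_halfspace_Re_gt)
    show "1 islimpt complex_of_real ` {0<..}"
    proof (rule islimptI)
      fix T :: "complex set" assume "1 \<in> T" "open T"
      then obtain e where e: "e > 0" "ball 1 e \<subseteq> T" by (meson openE)
      have "complex_of_real (1 + e / 2) \<in> T" using e by (intro subsetD[OF e(2)]) (simp add: dist_norm)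
      then show "\<exists>y\<in>complex_of_real ` {0<..}. y \<in> T \<and> y \<noteq> 1"
        using e by (intro bexI[of _ "complex_of_real (1 + e / 2)"] conjI imageI) (auto simp del: of_real_add)
    qed
    show "(LINT x|lborel. f z x) - exp (- of_real pi * (of_real \<xi>)\<^sup>2 / z) / csqrt z = 0"
      if "z \<in> complex_of_real ` {0<..}" for z
    proof -
      from that obtain t where t: "t > 0" "z = of_real t" by (metis imageE greaterThan_iff)
      show ?thesis
        using integral_gaussian_iexp_real[OF t(1), of \<xi>] t
        by (simp add: f_def csqrt_of_real_nonneg exp_of_real[symmetric])
    qed
  qed (use assms in \<open>auto simp: S_def\<close>)
  then show "(LINT x|lborel. exp (- of_real pi * w * (of_real x)\<^sup>2 - 2 * of_real pi * \<i> * of_real x * of_real \<xi>))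
      = exp (- of_real pi * (of_real \<xi>)\<^sup>2 / w) / csqrt w"
    by (simp add: f_def)
qed

end

text \<open>Fubini for product functions. \<open>lborel\<close> is the image of a product measure
  indexed by \<open>Basis\<close>, so \<open>k\<close> is introduced to recover the index
  \<open>j\<close> from the basis vector \<open>axis j 1\<close>.\<close>

lemma
  fixes h :: "'n::finite \<Rightarrow> real \<Rightarrow> complex"
  assumes "\<And>j. integrable lborel (h j)"
  shows integrable_lborel_vec_prod: "integrable lborel (\<lambda>x::real^'n. \<Prod>j\<in>UNIV. h j (x $ j))"
    and integral_lborel_vec_prod: "(LINT x|lborel. (\<Prod>j\<in>UNIV. h j (x $ j))) = (\<Prod>j\<in>UNIV. LINT x|lborel. h j x)"
proof -
  define k :: "real^'n \<Rightarrow> 'n" where "k = (\<lambda>b. THE j. b = axis j 1)"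
  have k: "k (axis j 1) = j" for j
    by (auto simp: k_def axis_eq_axis)
  have bij: "bij_betw (\<lambda>j. axis j 1) UNIV (Basis :: (real^'n) set)"
    by (auto simp: bij_betw_def inj_on_def axis_eq_axis Basis_vec_def)
  have prod: "(\<Prod>j\<in>UNIV. h j (x $ j)) = (\<Prod>b\<in>Basis. h (k b) (x \<bullet> b))" for x :: "real^'n"
    using prod.reindex_bij_betw[OF bij, of "\<lambda>b. h (k b) (x \<bullet> b)"] by (simp add: k inner_axis)
  have prod': "(\<Prod>b\<in>Basis. h (k b) ((\<Sum>c\<in>Basis. y c *\<^sub>R c) \<bullet> b)) = (\<Prod>b\<in>Basis. h (k b) (y b))" for y :: "real^'n \<Rightarrow> real"
    by (rule prod.cong) (auto simp: inner_sum_left inner_Basis if_distrib cong: if_cong)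
  interpret product_sigma_finite "\<lambda>b::real^'n. lborel :: real measure" by unfold_locales
  have [measurable]: "h j \<in> borel_measurable borel" for j
    using borel_measurable_integrable[OF assms[of j]] by simp
  have meas: "(\<lambda>f. \<Sum>b\<in>Basis. f b *\<^sub>R b) \<in> (\<Pi>\<^sub>M b\<in>(Basis :: (real^'n) set). lborel) \<rightarrow>\<^sub>M borel"
    by measurable
  have meas': "(\<lambda>x::real^'n. \<Prod>b\<in>Basis. h (k b) (x \<bullet> b)) \<in> borel_measurable borel"
    by measurable
  show "integrable lborel (\<lambda>x::real^'n. \<Prod>j\<in>UNIV. h j (x $ j))"
    unfolding prod lborel_eq[where 'a = "real^'n"]
    by (subst integrable_distr_eq[OF meas meas']) (auto simp: prod' intro!: product_integrable_prod assms)
  have "(LINT x|lborel. (\<Prod>j\<in>UNIV. h j (x $ j))) = (\<Prod>b\<in>(Basis :: (real^'n) set). LINT x|lborel. h (k b) x)"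
    unfolding prod lborel_eq[where 'a = "real^'n"]
    by (subst integral_distr[OF meas meas']) (auto simp: prod' intro!: product_integral_prod assms)
  also have "\<dots> = (\<Prod>j\<in>UNIV. LINT x|lborel. h j x)"
    using prod.reindex_bij_betw[OF bij, of "\<lambda>b. LINT x|lborel. h (k b) x"] by (simp add: k)
  finally show "(LINT x|lborel. (\<Prod>j\<in>UNIV. h j (x $ j))) = (\<Prod>j\<in>UNIV. LINT x|lborel. h j x)" .
qed

section \<open>Gaussians in several variables under the inversion\<close>

definition upper :: "complex^'n \<Rightarrow> bool" where
  "upper z \<longleftrightarrow> (\<forall>j. Im (z $ j) > 0)"

definition inversion :: "complex^'n \<Rightarrow> complex^'n" where
  "inversion z = (\<chi> j. - 1 / z $ j)"

text \<open>The automorphy factor of weight one half in each variable; the principal branch makes it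
  positive when all coordinates lie on the positive imaginary axis.\<close>

definition weight :: "complex^'n \<Rightarrow> complex" where
  "weight z = (\<Prod>j\<in>UNIV. 1 / csqrt (- \<i> * z $ j))"

lemma Im_minus_inverse: "Im (- 1 / w) = Im w / (norm w)\<^sup>2"
  by (simp add: Im_divide cmod_power2)

lemma upper_nonzero: "upper z \<Longrightarrow> z $ j \<noteq> 0"
  by (metis upper_def less_irrefl zero_complex.sel(2))

lemma upper_inversion: "upper z \<Longrightarrow> upper (inversion z)"
  using upper_nonzero[of z]
  unfolding upper_def inversion_def vec_lambda_beta Im_minus_inverse by simp

lemma inversion_inversion: "inversion (inversion z) = z"
  by (simp add: inversion_def vec_eq_iff)

text \<open>The numbers \<open>- \<i> * z $ j\<close> and \<open>- \<i> * (- 1 / z $ j)\<close> are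
  inverse to each other in the right half plane, where the principal root commutes with inversion.
  This expresses that the Fourier transform is an involution on Gaussians.\<close>

lemma weight_inversion:
  assumes "upper z"
  shows "weight z * weight (inversion z) = 1"
proof -
  have "csqrt (- \<i> * z $ j) * csqrt (- \<i> * (- 1 / z $ j)) = 1" for j
  proof -
    define w where "w = - \<i> * z $ j"
    have w: "Re w > 0" using assms by (simp add: upper_def w_def)
    then have "w \<notin> \<real>\<^sub>\<le>\<^sub>0" by (auto simp: complex_nonpos_Reals_iff)
    moreover have "- \<i> * (- 1 / z $ j) = inverse w"
      using upper_nonzero[OF assms, of j] by (simp add: w_def field_simps)
    ultimately have "csqrt w * csqrt (- \<i> * (- 1 / z $ j)) = csqrt w * inverse (csqrt w)"
      by (metis csqrt_inverse)
    also have "\<dots> = 1" using w by (intro right_inverse) auto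
    finally show ?thesis by (simp add: w_def)
  qed
  then show ?thesis
    by (simp add: weight_def inversion_def flip: prod.distrib prod_dividef)
qed

lemma gaussian_exponential_product:
  "gaussian z x * exp (- 2 * of_real pi * \<i> * of_real (x \<bullet> \<xi>))
   = (\<Prod>j\<in>UNIV. exp (- of_real pi * (- \<i> * z $ j) * (of_real (x $ j))\<^sup>2
        - 2 * of_real pi * \<i> * of_real (x $ j) * of_real (\<xi> $ j)))"
proof -
  have "exp (- 2 * of_real pi * \<i> * of_real (x \<bullet> \<xi>))
      = (\<Prod>j\<in>UNIV. exp (- 2 * of_real pi * \<i> * of_real (x $ j) * of_real (\<xi> $ j)))"
    by (subst exp_sum[symmetric]) (simp_all add: inner_vec_def sum_distrib_left mult_ac sum_negf)
  then show ?thesis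
    by (simp add: gaussian_def prod.distrib[symmetric] exp_add[symmetric] algebra_simps)
qed

lemma
  fixes z :: "complex^'n::finite"
  assumes "upper z"
  shows integrable_gaussian_exponential:
      "integrable lborel (\<lambda>x. gaussian z x * exp (- 2 * of_real pi * \<i> * of_real (x \<bullet> \<xi>)))"
    and fourier_gaussian: "fourier (gaussian z) \<xi> = weight z * gaussian (inversion z) \<xi>"
proof -
  have Re: "Re (- \<i> * z $ j) > 0" for j using assms by (simp add: upper_def)
  show "integrable lborel (\<lambda>x. gaussian z x * exp (- 2 * of_real pi * \<i> * of_real (x \<bullet> \<xi>)))"
    unfolding gaussian_exponential_product
    by (rule integrable_lborel_vec_prod[OF fourier_gaussian_real_line(1)[OF Re]])
  have "fourier (gaussian z) \<xi>
      = (\<Prod>j\<in>UNIV. exp (- of_real pi * (of_real (\<xi> $ j))\<^sup>2 / (- \<i> * z $ j)) / csqrt (- \<i> * z $ j))"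
    unfolding fourier_def gaussian_exponential_product
    by (subst integral_lborel_vec_prod[OF fourier_gaussian_real_line(1)[OF Re]])
      (simp only: fourier_gaussian_real_line(2)[OF Re])
  also have "\<dots> = (\<Prod>j\<in>UNIV. 1 / csqrt (- \<i> * z $ j) *
      exp (of_real pi * \<i> * (- 1 / z $ j) * of_real ((\<xi> $ j)\<^sup>2)))"
  proof (intro prod.cong refl)
    fix j :: 'n
    have "- p * q / (- \<i> * w) = p * \<i> * (- 1 / w) * q" if "w \<noteq> 0" for p q w :: complex
      using that by (simp add: field_simps)
    from this[OF upper_nonzero[OF assms, of j]]
    show "exp (- of_real pi * (of_real (\<xi> $ j))\<^sup>2 / (- \<i> * z $ j)) / csqrt (- \<i> * z $ j)
        = 1 / csqrt (- \<i> * z $ j) * exp (of_real pi * \<i> * (- 1 / z $ j) * of_real ((\<xi> $ j)\<^sup>2))"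
      by simp
  qed
  also have "\<dots> = weight z * gaussian (inversion z) \<xi>"
    by (simp add: weight_def gaussian_def inversion_def prod.distrib[symmetric] del: divide_minus_left)
  finally show "fourier (gaussian z) \<xi> = weight z * gaussian (inversion z) \<xi>" .
qed

section \<open>The span of the Gaussians\<close>

lemma gaussian_0: "gaussian z 0 = 1"
  by (simp add: gaussian_def)

text \<open>
  As a function of \<open>(x\<^sub>j\<^sup>2)\<^sub>j\<close> a Gaussian is a character of an additive semigroup; this makes
  Dedekind's independence argument applicable.
\<close>

lemma gaussian_sqrt_sum_squares:
  "gaussian z (\<chi> j. sqrt ((x $ j)\<^sup>2 + (y $ j)\<^sup>2)) = gaussian z x * gaussian z y"
  by (simp add: gaussian_def prod.distrib[symmetric] exp_add[symmetric] algebra_simps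
      del: of_real_power)

lemma inj_gaussian: "inj (gaussian :: complex^'n::finite \<Rightarrow> _)"
proof (rule injI, unfold vec_eq_iff, intro allI, rule ccontr)
  fix z w :: "complex^'n" and j
  assume eq: "gaussian z = gaussian w" and neq: "z $ j \<noteq> w $ j"
  define d where "d = of_real pi * \<i> * (z $ j - w $ j)"
  have "d \<noteq> 0" using neq by (simp add: d_def)
  \<comment> \<open>At this scale the two exponents differ by a number of modulus \<open>1\<close>,
    less than \<open>2 * pi\<close>, so equal exponentials force the difference to be
    \<open>0\<close>.\<close>
  define t where "t = sqrt (1 / norm d)"
  have t: "t\<^sup>2 = 1 / norm d" by (simp add: t_def)
  have g: "gaussian z' (t *\<^sub>R axis j 1) = exp (of_real pi * \<i> * z' $ j * of_real (t\<^sup>2))" for z' :: "complex^'n"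
  proof -
    have "gaussian z' (t *\<^sub>R axis j 1)
        = (\<Prod>i\<in>UNIV. if i = j then exp (of_real pi * \<i> * z' $ j * of_real (t\<^sup>2)) else 1)"
      unfolding gaussian_def by (intro prod.cong) (auto simp: axis_def)
    then show ?thesis by simp
  qed
  have "exp (d * of_real (t\<^sup>2)) = exp (of_real pi * \<i> * z $ j * of_real (t\<^sup>2)) / exp (of_real pi * \<i> * w $ j * of_real (t\<^sup>2))"
    by (simp only: exp_diff[symmetric]) (simp add: d_def algebra_simps)
  also have "\<dots> = 1" using fun_cong[OF eq, of "t *\<^sub>R axis j 1"] unfolding g by simp
  finally have "exp (d * of_real (t\<^sup>2)) = 1" .
  then obtain n :: int where n: "Re (d * of_real (t\<^sup>2)) = 0" "Im (d * of_real (t\<^sup>2)) = of_int (2 * n) * pi"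
    by (auto simp: exp_eq_1)
  have norm1: "norm (d * of_real (t\<^sup>2)) = 1" using \<open>d \<noteq> 0\<close> by (simp add: t norm_divide)
  then have "\<bar>Im (d * of_real (t\<^sup>2))\<bar> \<le> 1" by (metis abs_Im_le_cmod)
  then have "\<bar>real_of_int (2 * n)\<bar> * pi \<le> 1" unfolding n(2) by (simp add: abs_mult)
  then have "\<bar>real_of_int (2 * n)\<bar> < 1"
    using mult_right_mono[of 1 "\<bar>real_of_int (2 * n)\<bar>" pi] pi_gt3 by argo
  then have "n = 0" by simp
  then have "d * of_real (t\<^sup>2) = 0" using n by (simp add: complex_eq_iff)
  then show False using norm1 by (metis norm_zero zero_neq_one)
qed

lemma sum_fun_apply: "(\<Sum>i\<in>I. f i) x = (\<Sum>i\<in>I. f i x)" for f :: "'i \<Rightarrow> 'a \<Rightarrow> 'b::comm_monoid_add"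
  by (induction I rule: infinite_finite_induct) simp_all

lemma independent_gaussians: "cfun.independent (range (gaussian :: complex^'n::finite \<Rightarrow> _))"
  unfolding cfun.independent_explicit_finite_subsets
proof (intro allI impI ballI)
  fix S :: "(real^'n \<Rightarrow> complex) set" and u v
  assume S: "S \<subseteq> range gaussian" "finite S" and sum: "(\<Sum>f\<in>S. (\<lambda>x. u f * f x)) = 0" and "v \<in> S"
  show "u v = 0"
  proof (rule dedekind_independence[where I = S and \<phi> = "\<lambda>f. f" and e = 0
        and m = "\<lambda>x y. \<chi> j. sqrt ((x $ j)\<^sup>2 + (y $ j)\<^sup>2)" and c = u])
    show "(\<Sum>f\<in>S. u f * f x) = 0" for x
      using fun_cong[OF sum, of x] by (simp add: sum_fun_apply)
  qed (use S \<open>v \<in> S\<close> in \<open>auto simp: gaussian_sqrt_sum_squares gaussian_0\<close>)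
qed

text \<open>Coordinates refer to the family of all Gaussians, with no condition on the parameter, so
  that they can be evaluated at any point.\<close>

abbreviation gaussian_coeff :: "(real^'n \<Rightarrow> complex) \<Rightarrow> complex^'n::finite \<Rightarrow> complex" where
  "gaussian_coeff f z \<equiv> cfun.representation (range gaussian) f (gaussian z)"

lemma gaussian_span_eq: "gaussian_span = cfun.span (gaussian ` {z. upper z})"
  unfolding gaussian_span_def upper_def by (rule arg_cong[of _ _ cfun.span]) auto

lemma gaussian_in_gaussian_span: "upper z \<Longrightarrow> gaussian z \<in> gaussian_span"
  unfolding gaussian_span_eq by (intro cfun.span_base) simp

lemma subspace_gaussian_span: "cfun.subspace gaussian_span"
  unfolding gaussian_span_eq by (rule cfun.subspace_span)

lemma gaussian_span_subset: "gaussian_span \<subseteq> cfun.span (range gaussian)"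
  unfolding gaussian_span_eq by (rule cfun.span_mono) auto

lemma gaussian_span_add: "f \<in> gaussian_span \<Longrightarrow> g \<in> gaussian_span \<Longrightarrow> (\<lambda>x. f x + g x) \<in> gaussian_span"
  using cfun.subspace_add[OF subspace_gaussian_span, of f g] by (simp add: plus_fun_def)

lemma gaussian_span_scale: "f \<in> gaussian_span \<Longrightarrow> (\<lambda>x. a * f x) \<in> gaussian_span"
  by (rule cfun.subspace_scale[OF subspace_gaussian_span])

lemma gaussian_coeff_add:
  assumes "f \<in> gaussian_span" "g \<in> gaussian_span"
  shows "gaussian_coeff (\<lambda>x. f x + g x) z = gaussian_coeff f z + gaussian_coeff g z"
  using cfun.representation_add[OF independent_gaussians assms[THEN subsetD[OF gaussian_span_subset]]]
  by (simp add: plus_fun_def add.commute)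

lemma gaussian_coeff_scale:
  assumes "f \<in> gaussian_span"
  shows "gaussian_coeff (\<lambda>x. a * f x) z = a * gaussian_coeff f z"
  using cfun.representation_scale[OF independent_gaussians subsetD[OF gaussian_span_subset assms]] by simp

lemma gaussian_coeff_gaussian: "gaussian_coeff (gaussian w) z = (if w = z then 1 else 0)"
  using cfun.representation_basis[OF independent_gaussians, of "gaussian w"]
  by (auto dest: injD[OF inj_gaussian])

text \<open>Additivity of the Fourier integral rests on integrability, which the span inherits from
  its generators.\<close>

lemma integrable_gaussian_span:
  assumes "f \<in> gaussian_span"
  shows "integrable lborel (\<lambda>x. f x * exp (- 2 * of_real pi * \<i> * of_real (x \<bullet> \<xi>)))"
proof -
  define P where "P = {f. integrable lborel (\<lambda>x. f x * exp (- 2 * of_real pi * \<i> * of_real (x \<bullet> \<xi>)))}"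
  have "cfun.subspace P"
  proof (rule cfun.subspaceI)
    show "f + g \<in> P" if "f \<in> P" "g \<in> P" for f g
      using that unfolding P_def mem_Collect_eq plus_fun_apply distrib_right
      by (rule Bochner_Integration.integrable_add)
    show "(\<lambda>x. a * f x) \<in> P" if "f \<in> P" for a f
      using that unfolding P_def mem_Collect_eq mult.assoc
      by (rule integrable_mult_right)
  qed (simp add: P_def)
  moreover have "gaussian ` {z. upper z} \<subseteq> P"
    using integrable_gaussian_exponential by (auto simp only: P_def)
  ultimately have "gaussian_span \<subseteq> P"
    unfolding gaussian_span_eq by (intro cfun.span_minimal)
  then show ?thesis using assms by (auto simp only: P_def)
qed

lemma fourier_add:
  assumes "f \<in> gaussian_span" "g \<in> gaussian_span"
  shows "fourier (\<lambda>x. f x + g x) \<xi> = fourier f \<xi> + fourier g \<xi>"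
  unfolding fourier_def
  by (subst Bochner_Integration.integral_add[symmetric, OF integrable_gaussian_span[OF assms(1)] integrable_gaussian_span[OF assms(2)]])
    (simp add: distrib_right)

lemma fourier_scale: "fourier (\<lambda>x. a * f x) \<xi> = a * fourier f \<xi>"
  unfolding fourier_def mult.assoc by (rule integral_mult_right_zero)

lemma fourier_0: "fourier (\<lambda>x. 0) \<xi> = 0"
  by (simp add: fourier_def)

text \<open>For \<open>z\<close> in the product of upper half planes this is
  \<open>gaussian z + \<epsilon> * fourier (gaussian z)\<close> in closed form.\<close>

definition eigen :: "complex \<Rightarrow> complex^'n::finite \<Rightarrow> real^'n \<Rightarrow> complex" where
  "eigen \<epsilon> z x = gaussian z x + \<epsilon> * weight z * gaussian (inversion z) x"

lemma eigen_in_gaussian_span: "upper z \<Longrightarrow> eigen \<epsilon> z \<in> gaussian_span"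
  unfolding eigen_def[abs_def]
  by (intro gaussian_span_add gaussian_span_scale gaussian_in_gaussian_span upper_inversion)

lemma fourier_eigen:
  assumes "upper z" "\<epsilon> * \<epsilon> = 1"
  shows "fourier (eigen \<epsilon> z) \<xi> = \<epsilon> * eigen \<epsilon> z \<xi>"
proof -
  have "fourier (eigen \<epsilon> z) \<xi> = weight z * gaussian (inversion z) \<xi>
      + \<epsilon> * weight z * (weight (inversion z) * gaussian (inversion (inversion z)) \<xi>)"
    unfolding eigen_def[abs_def] using assms(1)
    by (simp add: fourier_add fourier_scale gaussian_span_scale gaussian_in_gaussian_span
        upper_inversion fourier_gaussian)
  also have "\<dots> = (\<epsilon> * \<epsilon>) * weight z * gaussian (inversion z) \<xi>
      + \<epsilon> * (weight z * weight (inversion z)) * gaussian z \<xi>"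
    by (simp add: assms(2) inversion_inversion)
  also have "\<dots> = \<epsilon> * eigen \<epsilon> z \<xi>"
    unfolding weight_inversion[OF assms(1)] by (simp add: eigen_def algebra_simps)
  finally show ?thesis .
qed

text \<open>The two contributions are added because \<open>z\<close> and \<open>inversion z\<close>
  may coincide.\<close>

lemma gaussian_coeff_eigen:
  assumes "upper z"
  shows "gaussian_coeff (eigen \<epsilon> z) v
    = (if z = v then 1 else 0) + \<epsilon> * weight z * (if inversion z = v then 1 else 0)"
  unfolding eigen_def[abs_def]
    gaussian_coeff_add[OF gaussian_in_gaussian_span[OF assms]
      gaussian_span_scale[OF gaussian_in_gaussian_span[OF upper_inversion[OF assms]]]]
    gaussian_coeff_scale[OF gaussian_in_gaussian_span[OF upper_inversion[OF assms]]]
    gaussian_coeff_gaussian ..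

text \<open>The set \<open>E\<close> is arbitrary: \<open>E = {}\<close> gives the full eigenspace,
  in which combinations are formed before vanishing is imposed.\<close>

lemma subspace_eigenspace:
  "cfun.subspace {f \<in> gaussian_span. fourier f = (\<lambda>x. \<epsilon> * f x) \<and> (\<forall>x\<in>E. f x = 0)}"
proof (rule cfun.subspaceI)
  show "0 \<in> {f \<in> gaussian_span. fourier f = (\<lambda>x. \<epsilon> * f x) \<and> (\<forall>x\<in>E. f x = 0)}"
    using cfun.subspace_0[OF subspace_gaussian_span] by (simp add: zero_fun_def fourier_0 fun_eq_iff)
next
  fix f g assume "f \<in> {f \<in> gaussian_span. fourier f = (\<lambda>x. \<epsilon> * f x) \<and> (\<forall>x\<in>E. f x = 0)}"
    "g \<in> {f \<in> gaussian_span. fourier f = (\<lambda>x. \<epsilon> * f x) \<and> (\<forall>x\<in>E. f x = 0)}"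
  then show "f + g \<in> {f \<in> gaussian_span. fourier f = (\<lambda>x. \<epsilon> * f x) \<and> (\<forall>x\<in>E. f x = 0)}"
    by (auto simp: plus_fun_def fun_eq_iff fourier_add gaussian_span_add algebra_simps)
next
  fix a f assume "f \<in> {f \<in> gaussian_span. fourier f = (\<lambda>x. \<epsilon> * f x) \<and> (\<forall>x\<in>E. f x = 0)}"
  then show "(\<lambda>x. a * f x) \<in> {f \<in> gaussian_span. fourier f = (\<lambda>x. \<epsilon> * f x) \<and> (\<forall>x\<in>E. f x = 0)}"
    by (auto simp: fun_eq_iff fourier_scale gaussian_span_scale)
qed

text \<open>The coordinates at the points \<open>v l\<close> form a dual system for the
  \<open>h k\<close>. Combinations taken from disjoint triples are nonzero with disjoint supports
  among these coordinates, so they are infinitely many independent elements of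
  \<open>W\<close>.\<close>

lemma infinite_dim_subspaceI:
  fixes h :: "nat \<Rightarrow> real^'n::finite \<Rightarrow> complex"
  assumes sub: "cfun.subspace W"
    and h: "\<And>k. h k \<in> gaussian_span"
    and coeff: "\<And>k l. gaussian_coeff (h k) (v l) = (if k = l then 1 else 0)"
    and triple: "\<And>i j k. \<exists>a b c. (a \<noteq> 0 \<or> b \<noteq> 0 \<or> c \<noteq> 0) \<and> (\<lambda>x. a * h i x + b * h j x + c * h k x) \<in> W"
  shows "infinite_dim_subspace W"
  unfolding infinite_dim_subspace_def
proof (intro conjI sub notI)
  assume "\<exists>B. finite B \<and> cfun.span B = W"
  then obtain B where B: "finite B" "cfun.span B = W" by blast
  define Q where "Q k p \<longleftrightarrow> (case p of (a, b, c) \<Rightarrow> (a \<noteq> 0 \<or> b \<noteq> 0 \<or> c \<noteq> 0) \<and>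
      (\<lambda>x. a * h (3 * k) x + b * h (3 * k + 1) x + c * h (3 * k + 2) x) \<in> W)" for k and p :: "complex \<times> complex \<times> complex"
  have "\<forall>k. \<exists>p. Q k p"
    using triple by (simp add: Q_def)
  from choice[OF this] obtain p where p: "\<And>k. Q k (p k)" by blast
  define a b c where "a k = fst (p k)" and "b k = fst (snd (p k))" and "c k = snd (snd (p k))" for k
  have abc: "a k \<noteq> 0 \<or> b k \<noteq> 0 \<or> c k \<noteq> 0"
    and W: "(\<lambda>x. a k * h (3 * k) x + b k * h (3 * k + 1) x + c k * h (3 * k + 2) x) \<in> W" for k
    using p[of k] by (auto simp: Q_def a_def b_def c_def split: prod.splits)
  define F where "F k = (\<lambda>x. a k * h (3 * k) x + b k * h (3 * k + 1) x + c k * h (3 * k + 2) x)" for k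
  have F_span: "F k \<in> gaussian_span" for k
    unfolding F_def by (intro gaussian_span_add gaussian_span_scale h)
  have F_coeff: "gaussian_coeff (F k) (v l) =
      a k * (if 3 * k = l then 1 else 0) + b k * (if 3 * k + 1 = l then 1 else 0) + c k * (if 3 * k + 2 = l then 1 else 0)" for k l
    by (simp only: F_def gaussian_coeff_add[OF gaussian_span_add[OF gaussian_span_scale[OF h] gaussian_span_scale[OF h]] gaussian_span_scale[OF h]]
      gaussian_coeff_add[OF gaussian_span_scale[OF h] gaussian_span_scale[OF h]]
      gaussian_coeff_scale[OF h] coeff)
  have F_other: "gaussian_coeff (F k) (v (3 * l + r)) = 0" if "k \<noteq> l" "r < 3" for k l r
    unfolding F_coeff using that by auto
  have F_same: "\<exists>r<3. gaussian_coeff (F k) (v (3 * k + r)) \<noteq> 0" for k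
  proof -
    have coeffs: "gaussian_coeff (F k) (v (3 * k + 0)) = a k" "gaussian_coeff (F k) (v (3 * k + 1)) = b k"
      "gaussian_coeff (F k) (v (3 * k + 2)) = c k"
      unfolding F_coeff by simp_all
    from abc[of k] consider "a k \<noteq> 0" | "b k \<noteq> 0" | "c k \<noteq> 0" by blast
    then show ?thesis
    proof cases
      case 1
      then show ?thesis using coeffs(1) by (intro exI[of _ 0]) simp
    next
      case 2
      then show ?thesis using coeffs(2) by (intro exI[of _ 1]) simp
    next
      case 3
      then show ?thesis using coeffs(3) by (intro exI[of _ 2]) simp
    qed
  qed
  \<comment> \<open>Independence concerns the set \<open>range F\<close>; injectivity makes this set
    infinite.\<close>
  have inj: "inj F"
    using F_same F_other by (intro injI) metis
  have indep: "cfun.independent (range F)"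
    unfolding cfun.independent_explicit_finite_subsets
  proof (intro allI impI ballI)
    fix T u f assume T: "T \<subseteq> range F" "finite T" and sum: "(\<Sum>f\<in>T. (\<lambda>x. u f * f x)) = 0" and "f \<in> T"
    obtain k where k: "f = F k" using T \<open>f \<in> T\<close> by auto
    obtain r where r: "r < 3" "gaussian_coeff (F k) (v (3 * k + r)) \<noteq> 0" using F_same by blast
    have T_span: "g \<in> gaussian_span" if "g \<in> T" for g using that T F_span by auto
    have "0 = gaussian_coeff (\<Sum>f\<in>T. (\<lambda>x. u f * f x)) (v (3 * k + r))"
      unfolding sum by (simp add: cfun.representation_zero)
    also have "\<dots> = (\<Sum>g\<in>T. gaussian_coeff (\<lambda>x. u g * g x) (v (3 * k + r)))"
      by (subst cfun.representation_sum[OF independent_gaussians])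
        (use gaussian_span_scale[OF T_span] subsetD[OF gaussian_span_subset] in auto)
    also have "\<dots> = (\<Sum>g\<in>T. u g * gaussian_coeff g (v (3 * k + r)))"
      by (intro sum.cong refl gaussian_coeff_scale T_span)
    also have "\<dots> = (\<Sum>g\<in>T. if g = f then u f * gaussian_coeff f (v (3 * k + r)) else 0)"
    proof (intro sum.cong refl)
      fix g assume "g \<in> T"
      then obtain l where l: "g = F l" using T by auto
      show "u g * gaussian_coeff g (v (3 * k + r)) = (if g = f then u f * gaussian_coeff f (v (3 * k + r)) else 0)"
        using F_other[of l k r] r(1) by (cases "l = k") (auto simp: l k inj_eq[OF inj])
    qed
    also have "\<dots> = u f * gaussian_coeff f (v (3 * k + r))"
      using T \<open>f \<in> T\<close> by simp
    finally show "u f = 0" using r(2) by (simp add: k)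
  qed
  have "range F \<subseteq> cfun.span B" using W by (auto simp: B F_def)
  then have "finite (range F)"
    using cfun.independent_span_bound[OF B(1) indep] by simp
  then show False using inj by (simp add: finite_image_iff)
qed

section \<open>Eigenfunctions vanishing on the discrete set\<close>

text \<open>
  The factorisation of \<open>diag(a, 1/a)\<close> into upper and lower unipotent matrices, written as
  alternating inversions and translations of a point of the upper half plane.
\<close>

lemma inversion_path:
  fixes w :: complex and a s :: real
  assumes w: "Im w > 1" "\<bar>a\<bar> * Im w > 1" and a: "a\<^sup>2 \<noteq> 1" and s: "s * s = 1"
    and q1_def: "q1 = - 1 / w + of_real (2 * s * a)"
    and q2_def: "q2 = - 1 / q1 + of_real (2 * s * ((1 / a - 1) / 4))"
    and q3_def: "q3 = - 1 / q2 + of_real (2 * s * (- 1))"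
  shows "- 1 / q3 = (of_real a)\<^sup>2 * w + of_real (s * (1 - a) / 2)"
    and "Im (- 1 / w) \<noteq> Im w" "Im q1 \<noteq> Im w" "Im (- 1 / q1) \<noteq> Im w" "Im q2 \<noteq> Im w"
    and "Im (- 1 / q2) \<noteq> Im w" "Im q3 \<noteq> Im w" "Im (- 1 / q3) \<noteq> Im w"
proof -
  have a0: "a \<noteq> 0" using w by auto
  have s2: "of_real s * of_real s = (1 :: complex)" using s by (simp flip: of_real_mult)
  have w0: "w \<noteq> 0" using w by auto
  have small: "Im w / (norm z)\<^sup>2 < Im w" if "\<bar>Im z\<bar> > 1" for z
  proof -
    have "norm z > 1" using abs_Im_le_cmod[of z] that by linarith
    then have "(norm z)\<^sup>2 > 1" by (simp add: one_less_power)
    then show ?thesis using w by (simp add: divide_less_eq)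
  qed
  \<comment> \<open>\<open>p\<close> and \<open>r\<close> are the linear forms in \<open>w\<close>
    that become denominators along the path: \<open>q1 = p / w\<close>, \<open>q2 = - r / p\<close>
    and \<open>q3 = - 1 / (a * r)\<close>.\<close>
  define p where "p = 2 * of_real s * of_real a * w - 1"
  define r where "r = of_real a * w + of_real (s * (1 / a - 1) / 2)"
  have Im_p: "\<bar>Im p\<bar> > 1"
  proof -
    have "\<bar>s\<bar> = 1" using s by (simp add: abs_square_eq_1[symmetric] power2_eq_square)
    then have "\<bar>Im p\<bar> = 2 * (\<bar>a\<bar> * Im w)" using w by (simp add: p_def abs_mult)
    then show ?thesis using w by simp
  qed
  have Im_r: "\<bar>Im r\<bar> > 1" using w by (simp add: r_def abs_mult)
  have p0: "p \<noteq> 0" and r0: "r \<noteq> 0" using Im_p Im_r by auto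
  have q1: "q1 = p / w" using w0 by (simp add: q1_def p_def field_simps)
  have "q2 = (- w + of_real (s * (1 / a - 1) / 2) * p) / p"
    using p0 by (simp add: q2_def q1 field_simps)
  also have "- w + of_real (s * (1 / a - 1) / 2) * p = - r"
  proof -
    have "of_real (s * (1 / a - 1) / 2) * (2 * of_real s * of_real a * w)
        = of_real s * of_real s * of_real ((1 / a - 1) * a) * w"
      by (simp add: field_simps)
    also have "(1 / a - 1) * a = 1 - a" using a0 by (simp add: field_simps)
    finally have "of_real (s * (1 / a - 1) / 2) * (2 * of_real s * of_real a * w) = w - of_real a * w"
      by (simp add: s2 algebra_simps)
    then show ?thesis by (simp add: p_def r_def right_diff_distrib)
  qed
  finally have q2: "q2 = - r / p" .
  have "q3 = (p - 2 * of_real s * r) / r"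
    using r0 p0 by (simp add: q3_def q2 field_simps)
  also have "p - 2 * of_real s * r = - 1 / of_real a"
  proof -
    have "2 * of_real s * (of_real (s * (1 / a - 1) / 2) :: complex) = of_real s * of_real s * of_real (1 / a - 1)"
      by (simp add: field_simps)
    also have "\<dots> = 1 / of_real a - 1" by (simp only: s2) simp
    finally have "2 * of_real s * r = 2 * of_real s * (of_real a * w) + (1 / of_real a - 1)"
      by (simp only: r_def distrib_left)
    then show ?thesis by (simp add: p_def)
  qed
  finally have q3: "q3 = - 1 / of_real a / r" .
  have inv_q3: "- 1 / q3 = of_real a * r" using a0 r0 by (simp add: q3)
  have "a * (s * (1 / a - 1) / 2) = s * (1 - a) / 2"
    using a0 by (simp add: field_simps)
  then have "of_real a * of_real (s * (1 / a - 1) / 2) = (of_real (s * (1 - a) / 2) :: complex)"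
    by (simp only: of_real_mult[symmetric])
  then show q3': "- 1 / q3 = (of_real a)\<^sup>2 * w + of_real (s * (1 - a) / 2)"
    by (simp only: inv_q3 r_def distrib_left power2_eq_square mult.assoc)
  \<comment> \<open>Real translations keep the imaginary part. After the successive inversions it is
    \<open>Im w\<close> over the squared norms of \<open>w\<close>, \<open>p\<close> and
    \<open>r\<close>, all greater than \<open>1\<close>, and finally
    \<open>a\<^sup>2 * Im w\<close>. Differing from \<open>Im w\<close>, these heights separate the
    points from all translates of the base point.\<close>
  have i0: "Im (- 1 / w) = Im w / (norm w)\<^sup>2" by (rule Im_minus_inverse)
  have i1: "Im (- 1 / q1) = Im w / (norm p)\<^sup>2"
  proof -
    have "Im q1 = Im w / (norm w)\<^sup>2" unfolding q1_def by (simp only: plus_complex.sel i0) simp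
    then show ?thesis
      unfolding Im_minus_inverse using w0 p0 by (simp add: q1 norm_divide power_divide)
  qed
  have i2: "Im (- 1 / q2) = Im w / (norm r)\<^sup>2"
  proof -
    have "Im q2 = Im w / (norm p)\<^sup>2" unfolding q2_def by (simp only: plus_complex.sel i1) simp
    then show ?thesis
      unfolding Im_minus_inverse using r0 p0 by (simp add: q2 norm_divide power_divide)
  qed
  show "Im (- 1 / w) \<noteq> Im w" unfolding i0 using small[of w] w by simp
  then show "Im q1 \<noteq> Im w" unfolding q1_def by simp
  show "Im (- 1 / q1) \<noteq> Im w" unfolding i1 using small[OF Im_p] by simp
  then show "Im q2 \<noteq> Im w" unfolding q2_def by simp
  show "Im (- 1 / q2) \<noteq> Im w" unfolding i2 using small[OF Im_r] by simp
  then show "Im q3 \<noteq> Im w" unfolding q3_def by simp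
  have "Im (- 1 / q3) = a\<^sup>2 * Im w" unfolding q3' by (simp flip: of_real_power)
  then show "Im (- 1 / q3) \<noteq> Im w" using a w by simp
qed

text \<open>Two linear equations in three unknowns. The generic solution is the cross product of the
  coefficient vectors up to sign; it could be zero only if all three values agree, which the first
  case covers.\<close>

lemma ex_vanishing_combination:
  fixes \<kappa>1 \<kappa>2 \<kappa>3 :: "'a::idom"
  obtains a b c where "a \<noteq> 0 \<or> b \<noteq> 0 \<or> c \<noteq> 0" "a + b + c = 0" "a * \<kappa>1 + b * \<kappa>2 + c * \<kappa>3 = 0"
proof (cases "\<kappa>1 = \<kappa>2")
  case True
  then show ?thesis using that[of 1 "- 1" 0] by simp
next
  case False
  then show ?thesis
    using that[of "\<kappa>2 - \<kappa>3" "\<kappa>3 - \<kappa>1" "\<kappa>1 - \<kappa>2"] by (simp add: algebra_simps)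
qed

section \<open>Lattice translations and the telescoping path\<close>

context real_embeddings
begin

lemma emb_numeral: "\<sigma> j (numeral k) = numeral k"
  using field_embedding_of_nat[OF emb, of j "numeral k"] by simp

lemma emb_divide: "\<sigma> j (x / y) = \<sigma> j x / \<sigma> j y"
  unfolding divide_inverse by (simp only: emb_simps)

text \<open>The sign cancels the absolute value in \<open>E_set\<close>, and the factor
  \<open>2\<close> turns \<open>pi * \<i>\<close> in the exponent of a Gaussian into a full
  period.\<close>

definition translate :: "'k \<Rightarrow> 'k \<Rightarrow> complex^'n \<Rightarrow> complex^'n" where
  "translate c r z = (\<chi> j. z $ j + of_real (2 * sgn (\<sigma> j c) * \<sigma> j r))"

lemma upper_translate: "upper z \<Longrightarrow> upper (translate c r z)"
  by (simp add: upper_def translate_def)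

text \<open>For \<open>x\<close> given by \<open>\<alpha>\<close>, the translation multiplies the
  value by \<open>exp (2 * pi * \<i> * T)\<close>, where \<open>T\<close> is the trace of
  \<open>r * (c * \<alpha>)\<close>. It is an integer since \<open>c * \<alpha>\<close> lies in the
  codifferent.\<close>

lemma gaussian_translate:
  assumes c: "c \<noteq> 0" and \<aa>: "(\<lambda>x. c * x) ` ideal_prod \<aa> \<aa> = codifferent"
    and r: "r \<in> ring_of_integers" and x: "x \<in> E_set \<sigma> c \<aa>"
  shows "gaussian (translate c r z) x = gaussian z x"
proof -
  obtain \<alpha> where \<alpha>: "\<alpha> \<in> ideal_prod \<aa> \<aa>" "\<And>j. \<sigma> j \<alpha> = (x $ j)\<^sup>2 / \<bar>\<sigma> j c\<bar>"
    using x by (auto simp: E_set_def)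
  have xsq: "sgn (\<sigma> j c) * (x $ j)\<^sup>2 = \<sigma> j (c * \<alpha>)" for j
    using c by (simp add: emb_simps \<alpha>(2) sgn_div_norm field_simps)
  have "c * \<alpha> \<in> codifferent" using \<alpha>(1) \<aa> by blast
  then have "field_trace (r * (c * \<alpha>)) \<in> \<int>" using r by (simp add: codifferent_def)
  then obtain n :: int where n: "field_trace (r * (c * \<alpha>)) = of_int n" by (elim Ints_cases)
  have "gaussian (translate c r z) x
      = (\<Prod>j\<in>UNIV. exp (of_real pi * \<i> * z $ j * of_real ((x $ j)\<^sup>2)) * exp (of_real (2 * pi * \<sigma> j (r * (c * \<alpha>))) * \<i>))"
    unfolding gaussian_def
  proof (intro prod.cong refl)
    fix j
    have "2 * sgn (\<sigma> j c) * \<sigma> j r * (x $ j)\<^sup>2 = 2 * \<sigma> j (r * (c * \<alpha>))"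
      using xsq[of j] by (simp add: emb_simps mult_ac)
    then have "complex_of_real (2 * sgn (\<sigma> j c) * \<sigma> j r) * of_real ((x $ j)\<^sup>2) = of_real (2 * \<sigma> j (r * (c * \<alpha>)))"
      by (simp only: of_real_mult[symmetric])
    then show "exp (of_real pi * \<i> * translate c r z $ j * of_real ((x $ j)\<^sup>2))
        = exp (of_real pi * \<i> * z $ j * of_real ((x $ j)\<^sup>2)) * exp (of_real (2 * pi * \<sigma> j (r * (c * \<alpha>))) * \<i>)"
      unfolding exp_add[symmetric] translate_def
      by (intro arg_cong[of _ _ exp]) (simp add: algebra_simps)
  qed
  also have "\<dots> = gaussian z x * exp (\<Sum>j\<in>UNIV. of_real (2 * pi * \<sigma> j (r * (c * \<alpha>))) * \<i>)"
    by (simp only: prod.distrib gaussian_def exp_sum[OF finite])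
  also have "(\<Sum>j\<in>UNIV. of_real (2 * pi * \<sigma> j (r * (c * \<alpha>))) * \<i>)
      = of_real (2 * pi * (\<Sum>j\<in>UNIV. \<sigma> j (r * (c * \<alpha>)))) * \<i>"
    by (simp only: sum_distrib_left of_real_sum sum_distrib_right)
  also have "(\<Sum>j\<in>UNIV. \<sigma> j (r * (c * \<alpha>))) = of_int n"
    unfolding field_trace_eq_sum_embeddings[symmetric] n by simp
  also have "exp (of_real (2 * pi * of_int n) * \<i>) = (1 :: complex)"
    using exp_integer_2pi[of "of_int n"] by (simp add: mult_ac)
  finally show ?thesis by simp
qed

lemma infinite_dim_eigenspace:
  assumes card: "CARD('n) \<ge> 2" and c: "c \<noteq> 0"
    and \<aa>: "(\<lambda>x. c * x) ` ideal_prod \<aa> \<aa> = codifferent" and \<epsilon>: "\<epsilon> * \<epsilon> = 1"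
  shows "infinite_dim_subspace
           {f :: real^'n \<Rightarrow> complex. f \<in> gaussian_span \<and>
              fourier f = (\<lambda>x. \<epsilon> * f x) \<and> (\<forall>x\<in>E_set \<sigma> c \<aa>. f x = 0)}"
proof -
  obtain M :: "'k set" and u :: 'k
    where M: "M \<subseteq> ring_of_integers" "1 \<in> M" "\<And>x y. x \<in> M \<Longrightarrow> y \<in> M \<Longrightarrow> x + y \<in> M"
      "\<And>x y. x \<in> M \<Longrightarrow> y \<in> M \<Longrightarrow> x * y \<in> M" "\<And>x. x \<in> M \<Longrightarrow> - x \<in> M"
      and u: "u \<noteq> 0" "u \<noteq> 1" "u \<noteq> - 1" "(u - 1) / 4 \<in> M" "(1 / u - 1) / 4 \<in> M"
    using exists_unit_cong_1_mod_4[OF card] by metis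
  have M_nat: "of_nat k \<in> M" for k
  proof (induction k)
    case 0
    have "1 + - 1 \<in> M" using M by blast
    then show ?case by simp
  qed (auto simp: M)
  have uM: "u \<in> M"
  proof -
    have "of_nat 4 * ((u - 1) / 4) + 1 \<in> M"
      by (rule M(3)[OF M(4)[OF M_nat u(4)] M(2)])
    moreover have "of_nat 4 * ((u - 1) / 4) + 1 = u" by (simp add: divide_simps)
    ultimately show ?thesis by simp
  qed
  define s where "s j = sgn (\<sigma> j c)" for j
  have s: "s j * s j = 1" for j using c by (simp add: s_def emb_simps sgn_mult_self_eq flip: sgn_mult)
  \<comment> \<open>A height above \<open>1\<close> and above every
    \<open>1 / \<bar>\<sigma> j u\<bar>\<close>, as \<open>inversion_path\<close> requires.\<close>
  define t where "t = Max (range (\<lambda>j. 1 + 1 / \<bar>\<sigma> j u\<bar>))"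
  have t: "t \<ge> 1 + 1 / \<bar>\<sigma> j u\<bar>" for j unfolding t_def by (intro Max_ge) auto
  have a0: "\<bar>\<sigma> j u\<bar> > 0" for j using u by (simp add: emb_simps)
  have t1: "t > 1"
    using t[of undefined] a0[of undefined] by (smt (verit) divide_pos_pos)
  have t2: "\<bar>\<sigma> j u\<bar> * t > 1" for j
  proof -
    have "\<bar>\<sigma> j u\<bar> * t \<ge> \<bar>\<sigma> j u\<bar> * (1 + 1 / \<bar>\<sigma> j u\<bar>)"
      using t[of j] a0[of j] by (intro mult_left_mono) auto
    also have "\<bar>\<sigma> j u\<bar> * (1 + 1 / \<bar>\<sigma> j u\<bar>) = \<bar>\<sigma> j u\<bar> + 1"
      using a0[of j] by (simp add: field_simps)
    finally show ?thesis using a0[of j] by simp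
  qed
  \<comment> \<open>\<open>zD\<close> is the image of \<open>z0\<close> under the whole word, read
    off from the first conclusion of \<open>inversion_path\<close>.\<close>
  define z0 zD :: "complex^'n" where "z0 = (\<chi> j. \<i> * of_real t)"
    and "zD = (\<chi> j. (of_real (\<sigma> j u))\<^sup>2 * (\<i> * of_real t) + of_real (s j * (1 - \<sigma> j u) / 2))"
  define v q1 q2 q3 where "v k = translate c (of_nat k) z0" and "q1 k = translate c u (inversion (v k))"
    and "q2 k = translate c ((1 / u - 1) / 4) (inversion (q1 k))"
    and "q3 k = translate c (- 1) (inversion (q2 k))" for k
  have up: "upper z0" "upper (v k)" "upper (q1 k)" "upper (q2 k)" "upper (q3 k)" for k
    using t1 by (auto simp: v_def q1_def q2_def q3_def upper_def[of z0] z0_def intro!: upper_translate upper_inversion)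
      (auto simp: upper_def)
  have comp: "v k $ j = \<i> * of_real t + of_real (2 * s j * of_nat k)"
    "q1 k $ j = - 1 / v k $ j + of_real (2 * s j * \<sigma> j u)"
    "q2 k $ j = - 1 / q1 k $ j + of_real (2 * s j * ((1 / \<sigma> j u - 1) / 4))"
    "q3 k $ j = - 1 / q2 k $ j + of_real (2 * s j * (- 1))" for k j
    by (simp_all only: v_def z0_def q1_def q2_def q3_def translate_def inversion_def s_def emb_simps
        emb_divide emb_numeral vec_lambda_beta)
  have Im_v: "Im (v k $ j) = t" for k j by (simp add: comp)
  have a1: "(\<sigma> j u)\<^sup>2 \<noteq> 1" for j
  proof -
    have "\<sigma> j u \<noteq> \<sigma> j 1" "\<sigma> j u \<noteq> \<sigma> j (- 1)"
      unfolding field_embedding_eq_iff[OF emb] by (rule u)+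
    then show ?thesis by (simp add: power2_eq_1_iff emb_simps)
  qed
  have path_prems: "Im (v k $ j) > 1" "\<bar>\<sigma> j u\<bar> * Im (v k $ j) > 1" for k j
    using t1 t2 by (simp_all add: Im_v)
  note path = inversion_path[OF path_prems a1 s comp(2-4)]
  \<comment> \<open>The word multiplies by \<open>u\<^sup>2\<close> and adds a constant, so a start
    shifted by \<open>k\<close> ends shifted by \<open>k * u\<^sup>2\<close>. This is again a
    lattice translation, invisible on \<open>E\<close>.\<close>
  have end_point: "inversion (q3 k) = translate c (of_nat k * u\<^sup>2) zD" for k
  proof -
    have "- 1 / q3 k $ j = zD $ j + of_real (2 * s j * \<sigma> j (of_nat k * u\<^sup>2))" for j
      unfolding path(1) comp(1) by (simp add: zD_def emb_simps power2_eq_square algebra_simps)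
    then show ?thesis by (simp add: vec_eq_iff inversion_def translate_def s_def)
  qed
  \<comment> \<open>The coefficients make the restrictions to the set \<open>E\<close> telescope along the path.\<close>
  define c1 where "c1 k = - \<epsilon> * weight (v k)" for k
  define c2 where "c2 k = - \<epsilon> * weight (q1 k) * c1 k" for k
  define c3 where "c3 k = - \<epsilon> * weight (q2 k) * c2 k" for k
  \<comment> \<open>The coefficient of the last inverted Gaussian, the only one besides the first to
    survive telescoping. It may depend on \<open>k\<close>, so restrictions to \<open>E\<close> span
    at most two dimensions and triples are needed.\<close>
  define \<kappa> where "\<kappa> k = \<epsilon> * weight (q3 k) * c3 k" for k
  define h where "h k = (\<lambda>x. eigen \<epsilon> (v k) x + c1 k * eigen \<epsilon> (q1 k) x
      + c2 k * eigen \<epsilon> (q2 k) x + c3 k * eigen \<epsilon> (q3 k) x)" for k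
  have h_on_E: "h k x = gaussian z0 x + \<kappa> k * gaussian zD x" if x: "x \<in> E_set \<sigma> c \<aa>" for k x
  proof -
    have kM: "of_nat k * u\<^sup>2 \<in> M" unfolding power2_eq_square by (intro M(4) M_nat uM)
    note tr = gaussian_translate[OF c \<aa> subsetD[OF M(1)] x]
    have "gaussian (v k) x = gaussian z0 x" unfolding v_def by (rule tr[OF M_nat])
    moreover have "gaussian (q1 k) x = gaussian (inversion (v k)) x" unfolding q1_def by (rule tr[OF uM])
    moreover have "gaussian (q2 k) x = gaussian (inversion (q1 k)) x" unfolding q2_def by (rule tr[OF u(5)])
    moreover have "gaussian (q3 k) x = gaussian (inversion (q2 k)) x" unfolding q3_def by (rule tr[OF M(5)[OF M(2)]])
    moreover have "gaussian (inversion (q3 k)) x = gaussian zD x" unfolding end_point by (rule tr[OF kM])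
    ultimately show ?thesis
      by (simp add: h_def eigen_def c1_def c2_def c3_def \<kappa>_def algebra_simps)
  qed
  define V where "V = {f :: real^'n \<Rightarrow> complex. f \<in> gaussian_span \<and> fourier f = (\<lambda>x. \<epsilon> * f x) \<and> (\<forall>x\<in>{}. f x = 0)}"
  have sub: "cfun.subspace V" unfolding V_def by (rule subspace_eigenspace)
  have V_add: "(\<lambda>x. f x + g x) \<in> V" if "f \<in> V" "g \<in> V" for f g
    using cfun.subspace_add[OF sub that] by (simp add: plus_fun_def)
  note V_scale = cfun.subspace_scale[OF sub]
  have eigen_V: "eigen \<epsilon> z \<in> V" if "upper z" for z
    using that \<epsilon> by (simp add: V_def eigen_in_gaussian_span fourier_eigen fun_eq_iff)
  have hV: "h k \<in> V" for k
    unfolding h_def by (intro V_add V_scale eigen_V up)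
  show ?thesis
  proof (rule infinite_dim_subspaceI[where h = h and v = v])
    show "cfun.subspace {f :: real^'n \<Rightarrow> complex. f \<in> gaussian_span \<and>
              fourier f = (\<lambda>x. \<epsilon> * f x) \<and> (\<forall>x\<in>E_set \<sigma> c \<aa>. f x = 0)}"
      by (rule subspace_eigenspace)
    show "h k \<in> gaussian_span" for k using hV by (simp add: V_def)
    show "gaussian_coeff (h k) (v l) = (if k = l then 1 else 0)" for k l
    proof -
      \<comment> \<open>Any single coordinate distinguishes the points: all \<open>v l\<close> have
        height \<open>t\<close> there, the other points on the path do not, and the
        \<open>v l\<close> differ among themselves in the real part.\<close>
      obtain j :: 'n where True by simp
      have neq: "z \<noteq> v l" if "Im (z $ j) \<noteq> Im (v k $ j)" for z
        using that by (auto simp: Im_v)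
      have "inversion (v k) \<noteq> v l" "q1 k \<noteq> v l" "inversion (q1 k) \<noteq> v l" "q2 k \<noteq> v l"
        "inversion (q2 k) \<noteq> v l" "q3 k \<noteq> v l" "inversion (q3 k) \<noteq> v l"
        by (rule neq, (unfold inversion_def vec_lambda_beta)?, rule path)+
      moreover have "v k = v l \<longleftrightarrow> k = l"
      proof
        assume "v k = v l"
        then have "Re (v k $ j) = Re (v l $ j)" by (rule arg_cong)
        then show "k = l" using s[of j] by (auto simp: comp)
      qed simp
      moreover have E: "eigen \<epsilon> (v k) \<in> gaussian_span" "(\<lambda>x. c1 k * eigen \<epsilon> (q1 k) x) \<in> gaussian_span"
        "(\<lambda>x. c2 k * eigen \<epsilon> (q2 k) x) \<in> gaussian_span" "(\<lambda>x. c3 k * eigen \<epsilon> (q3 k) x) \<in> gaussian_span"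
        by (intro gaussian_span_scale eigen_in_gaussian_span up)+
      have "gaussian_coeff (h k) (v l) = gaussian_coeff (eigen \<epsilon> (v k)) (v l)
          + c1 k * gaussian_coeff (eigen \<epsilon> (q1 k)) (v l) + c2 k * gaussian_coeff (eigen \<epsilon> (q2 k)) (v l)
          + c3 k * gaussian_coeff (eigen \<epsilon> (q3 k)) (v l)"
        unfolding h_def gaussian_coeff_add[OF gaussian_span_add[OF gaussian_span_add[OF E(1,2)] E(3)] E(4)]
          gaussian_coeff_add[OF gaussian_span_add[OF E(1,2)] E(3)] gaussian_coeff_add[OF E(1,2)]
          gaussian_coeff_scale[OF eigen_in_gaussian_span[OF up(3)]]
          gaussian_coeff_scale[OF eigen_in_gaussian_span[OF up(4)]]
          gaussian_coeff_scale[OF eigen_in_gaussian_span[OF up(5)]] by (rule refl)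
      ultimately show ?thesis
        by (simp add: gaussian_coeff_eigen up)
    qed
    show "\<exists>a b c'. (a \<noteq> 0 \<or> b \<noteq> 0 \<or> c' \<noteq> 0) \<and> (\<lambda>x. a * h i x + b * h j x + c' * h k x) \<in>
        {f :: real^'n \<Rightarrow> complex. f \<in> gaussian_span \<and>
              fourier f = (\<lambda>x. \<epsilon> * f x) \<and> (\<forall>x\<in>E_set \<sigma> c \<aa>. f x = 0)}" for i j k
    proof -
      obtain a b c' where abc: "a \<noteq> 0 \<or> b \<noteq> 0 \<or> c' \<noteq> 0" "a + b + c' = 0" "a * \<kappa> i + b * \<kappa> j + c' * \<kappa> k = 0"
        by (rule ex_vanishing_combination)
      have "(\<lambda>x. a * h i x + b * h j x + c' * h k x) \<in> V"
        by (intro V_add V_scale hV)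
      moreover have "a * h i x + b * h j x + c' * h k x = 0" if "x \<in> E_set \<sigma> c \<aa>" for x
      proof -
        have "a * h i x + b * h j x + c' * h k x
            = (a + b + c') * gaussian z0 x + (a * \<kappa> i + b * \<kappa> j + c' * \<kappa> k) * gaussian zD x"
          by (simp add: h_on_E[OF that] algebra_simps)
        then show ?thesis by (simp add: abc)
      qed
      ultimately show ?thesis using abc(1) unfolding V_def by blast
    qed
  qed
qed

end

theorem theorem2:
  fixes \<sigma> :: "'n::finite \<Rightarrow> 'k::field_char_0 \<Rightarrow> real"
    and c :: 'k and \<aa> :: "'k set" and \<epsilon> :: complex
  assumes "number_field TYPE('k)"
    and "totally_real TYPE('k)"
    and "field_degree TYPE('k) = CARD('n)"
    and "CARD('n) \<ge> 2"
    and "bij_betw \<sigma> UNIV {\<tau> :: 'k \<Rightarrow> real. field_embedding \<tau>}"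
    and "c \<noteq> 0"
    and "fractional_ideal \<aa>"
    and "(\<lambda>x. c * x) ` ideal_prod \<aa> \<aa> = codifferent"
    and "\<epsilon> \<in> {1, -1}"
  shows "infinite_dim_subspace
           {f :: real^'n \<Rightarrow> complex. f \<in> gaussian_span \<and>
              fourier f = (\<lambda>x. \<epsilon> * f x) \<and>
              (\<forall>x\<in>E_set \<sigma> c \<aa>. f x = 0)}"
proof -
  interpret real_embeddings \<sigma>
    by unfold_locales (use assms(1,3,5) in \<open>auto simp: bij_betw_def\<close>)
  show ?thesis
    by (rule infinite_dim_eigenspace) (use assms in auto)
qed

end
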